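(* Let $g$ be a derivator, $a<b$ real numbers, $\mathbb F\in\{\mathbb R,\mathbb C\}$ and $n\ge1$ an integer. Let $\operatorname{L}$ be either a linear functional $\operatorname{L}\in\operatorname{R}([a,b],\mathbb F)^*$ or a linear endomorphism $\operatorname{L}:\operatorname{R}([a,b],\mathbb F)\to\operatorname{R}([a,b],\mathbb F)$. Suppose that: I. for all $f\in\mathcal L^1_g([a,b),\mathbb F)$, $$\operatorname{L}\left(\int_{[a,b)}f(s)K^+_n(\cdot,s)\,d\mu_g(s)\right)=\int_{[a,b)}f(s)\operatorname{L}(K^+_n(\cdot,s))\,d\mu_g(s);$$ II. $\operatorname{L}(p)=0$ for every $p\in\operatorname{P}_{n-1}$. Then, if $f:[a,b]\to\mathbb R$ is an $n-1$ times $g$-differentiable function such that $f^{(k)}_g$ is $g$-absolutely continuous for $k\in\{0,\dots,n-1\}$, $$\operatorname{L}(f)=-\frac1{n!}\int_{[a,b)}f^{(n)}_g(s)\operatorname{L}(K^+_n(\cdot,s))\,d\mu_g(s).$$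
   Context: A derivator is a left-continuous nondecreasing function $g:\mathbb R\to\mathbb R$; $\mu_g$ is the Lebesgue–Stieltjes measure with $\mu_g([c,d))=g(d)-g(c)$; $\mathcal L^1_g([a,b),\mathbb F)$ is the space of $\mu_g$-integrable functions $[a,b)\to\mathbb F$. $\Delta g(t)=g(t^+)-g(t)$, $D_g=\{t:\Delta g(t)>0\}$, $C_g$ is the open set of points near which $g$ is constant, with component intervals $(a_m,b_m)$. $\operatorname{R}([a,b],\mathbb F)$ is the space of regulated functions $[a,b]\to\mathbb F$ (one-sided limits exist at every point). When $\operatorname{L}$ is an endomorphism, the integrals of function-valued expressions are understood pointwise in $x\in[a,b]$. Put $\int_x^y f\,d\mu_g=\int_{[x,y)}f\,d\mu_g$ if $y\ge x$ and $-\int_{[y,x)}f\,d\mu_g$ if $y<x$. For $x_0\in\mathbb R$ the $g$-monomials are $g_{x_0,0}(x)=1$, $g_{x_0,k}(x)=k\int_{x_0}^xg_{x_0,k-1}\,d\mu_g$ ($k\ge1$). $\operatorname{P}_{m}$ is the $\mathbb F$-span of $g_{x_0,0},\dots,g_{x_0,m}$ (independent of $x_0$), restricted here to $[a,b]$. The kernel is, for $x,s\in[a,b]$, $$K^+_n(x,s)=\begin{cases}n!(-1)^n\sum_{k=0}^{n-1}\frac{(-1)^k(\Delta g(s))^{n-1-k}}{k!}g_{s,k}(x),&s\in[a,x),\\0,&s\in[x,b],\end{cases}$$ with $(\Delta g(s))^0=1$. For each $s$, $K_n^+(\cdot,s)$ is regulated, and for $f\in\mathcal L^1_g([a,b),\mathbb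 F)$ the function $x\mapsto\int_{[a,b)}f(s)K^+_n(x,s)\,d\mu_g(s)$ is $g$-absolutely continuous, hence regulated. The $g$-derivative: $f'_g(t)=\lim_{s\to t}\frac{f(s)-f(t)}{g(s)-g(t)}$ if $t\notin D_g\cup C_g$; $\lim_{s\to t^+}\frac{f(s)-f(t)}{g(s)-g(t)}$ if $t\in D_g$; $\lim_{s\to b_m^+}\frac{f(s)-f(b_m)}{g(s)-g(b_m)}$ if $t\in(a_m,b_m)$; provided the limit can be considered and exists (limits taken within the domain $[a,b]$ and over those $s$ where the quotient is defined). $f^{(0)}_g=f$, $f^{(k+1)}_g=(f^{(k)}_g)'_g$. A function $F:[a,b]\to\mathbb F$ is $g$-absolutely continuous if for every $\varepsilon>0$ there is $\delta>0$ such that for any finite family of pairwise disjoint open subintervals $(c_m,d_m)$ of $[a,b]$, $\sum(g(d_m)-g(c_m))<\delta$ implies $\sum|F(d_m)-F(c_m)|<\varepsilon$. Such functions are $g$-differentiable $\mu_g$-a.e. on $[a,b)$ with $\mu_g$-integrable derivative, so $f^{(n)}_g$ is defined $\mu_g$-a.e. *)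

theory Defs
  imports "HOL-Analysis.Analysis"
begin

text \<open>The scalar field is a type of class \<open>{real_normed_field, euclidean_space}\<close>: a
  commutative field of finite dimension over the reals, hence a copy of \<open>real\<close> or \<open>complex\<close>.\<close>

section \<open>Derivators and the Lebesgue-Stieltjes measure\<close>

definition derivator :: "(real \<Rightarrow> real) \<Rightarrow> bool" where
  "derivator g \<longleftrightarrow> mono g \<and> (\<forall>t. continuous (at_left t) g)"

text \<open>\<open>interval_measure\<close> takes a right-continuous function and half-open intervals
  \<open>{c<..d}\<close>; reflecting at the origin turns this into the left-continuous case with intervals
  \<open>{c..<d}\<close>.  The measure is completed, so that functions known only almost everywhere
  have a well-defined integral.\<close>

definition stieltjes :: "(real \<Rightarrow> real) \<Rightarrow> real measure" where
  "stieltjes g = completion (distr (interval_measure (\<lambda>t. - g (- t))) borel uminus)"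

lemma emeasure_stieltjes_Ico:
  assumes g: "derivator g" and cd: "c \<le> d"
  shows "emeasure (stieltjes g) {c..<d} = ennreal (g d - g c)"
proof -
  let ?h = "\<lambda>t. - g (- t)"
  have m: "?h x \<le> ?h y" if "x \<le> y" for x y
    using g that by (simp add: derivator_def mono_def)
  have rc: "continuous (at_right t) ?h" for t
  proof -
    have "(g \<longlongrightarrow> g (- t)) (at_left (- t))"
      using g by (auto simp: derivator_def continuous_within)
    then have "((\<lambda>s. g (- s)) \<longlongrightarrow> g (- t)) (at_right t)"
      by (simp add: filterlim_at_left_to_right)
    then show ?thesis
      by (auto simp: continuous_within intro!: tendsto_minus)
  qed
  have "uminus -` {c..<d} = {- d<..- c}"
    by auto
  then have "emeasure (distr (interval_measure ?h) borel uminus) {c..<d} = ennreal (g d - g c)"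
    using emeasure_interval_measure_Ioc[of "- d" "- c" ?h] m rc cd by (simp add: emeasure_distr)
  then show ?thesis
    by (simp add: stieltjes_def)
qed

definition jump :: "(real \<Rightarrow> real) \<Rightarrow> real \<Rightarrow> real" where
  "jump g t = Lim (at_right t) g - g t"

definition jump_set :: "(real \<Rightarrow> real) \<Rightarrow> real set" where
  "jump_set g = {t. jump g t > 0}"

definition const_set :: "(real \<Rightarrow> real) \<Rightarrow> real set" where
  "const_set g = {t. \<forall>\<^sub>F s in nhds t. g s = g t}"

section \<open>Monomials, polynomials and the kernel\<close>

definition gint :: "(real \<Rightarrow> real) \<Rightarrow> real \<Rightarrow> real \<Rightarrow> (real \<Rightarrow> real) \<Rightarrow> real" where
  "gint g x y f =
     (if x \<le> y then (LINT s:{x..<y}|stieltjes g. f s) else - (LINT s:{y..<x}|stieltjes g. f s))"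

primrec gmonom :: "(real \<Rightarrow> real) \<Rightarrow> real \<Rightarrow> nat \<Rightarrow> real \<Rightarrow> real" where
  "gmonom g x0 0 = (\<lambda>x. 1)"
| "gmonom g x0 (Suc k) = (\<lambda>x. real (Suc k) * gint g x0 x (gmonom g x0 k))"

definition gpolys ::
    "(real \<Rightarrow> real) \<Rightarrow> real \<Rightarrow> real \<Rightarrow> real \<Rightarrow> nat \<Rightarrow> (real \<Rightarrow> 'a::real_normed_field) set" where
  "gpolys g x0 a b m =
     {\<lambda>x\<in>{a..b}. \<Sum>k\<le>m. c k * of_real (gmonom g x0 k x) | c. True}"

definition gkernel :: "(real \<Rightarrow> real) \<Rightarrow> nat \<Rightarrow> real \<Rightarrow> real \<Rightarrow> real" where
  "gkernel g n x s =
     (if s < x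
      then fact n * (- 1) ^ n *
        (\<Sum>k<n. (- 1) ^ k * jump g s ^ (n - 1 - k) / fact k * gmonom g s k x)
      else 0)"

section \<open>Regulated functions and linear maps on them\<close>

text \<open>Functions on \<open>[a,b]\<close> are represented as elements of \<open>extensional {a..b}\<close>.\<close>

definition regulated :: "real \<Rightarrow> real \<Rightarrow> (real \<Rightarrow> 'a::real_normed_field) set" where
  "regulated a b = {f \<in> extensional {a..b}.
     (\<forall>t\<in>{a..<b}. \<exists>l. (f \<longlongrightarrow> l) (at_right t)) \<and> (\<forall>t\<in>{a<..b}. \<exists>l. (f \<longlongrightarrow> l) (at_left t))}"

definition regulated_functional ::
    "real \<Rightarrow> real \<Rightarrow> ((real \<Rightarrow> 'a::real_normed_field) \<Rightarrow> 'a) \<Rightarrow> bool" where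
  "regulated_functional a b L \<longleftrightarrow>
     (\<forall>u\<in>regulated a b. \<forall>v\<in>regulated a b. L (\<lambda>x\<in>{a..b}. u x + v x) = L u + L v) \<and>
     (\<forall>c. \<forall>u\<in>regulated a b. L (\<lambda>x\<in>{a..b}. c * u x) = c * L u)"

definition regulated_endomorphism ::
    "real \<Rightarrow> real \<Rightarrow> ((real \<Rightarrow> 'a::real_normed_field) \<Rightarrow> (real \<Rightarrow> 'a)) \<Rightarrow> bool" where
  "regulated_endomorphism a b L \<longleftrightarrow>
     (\<forall>u\<in>regulated a b. L u \<in> regulated a b) \<and>
     (\<forall>u\<in>regulated a b. \<forall>v\<in>regulated a b.
        L (\<lambda>x\<in>{a..b}. u x + v x) = (\<lambda>x\<in>{a..b}. L u x + L v x)) \<and>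
     (\<forall>c. \<forall>u\<in>regulated a b. L (\<lambda>x\<in>{a..b}. c * u x) = (\<lambda>x\<in>{a..b}. c * L u x))"

section \<open>The derivative with respect to a derivator\<close>

text \<open>\<open>const_end g t\<close> is the right endpoint of the component interval of \<open>const_set g\<close>
  containing \<open>t\<close>.  Only meaningful if that interval is bounded above, which
  \<open>has_gderiv\<close> demands.\<close>

definition const_end :: "(real \<Rightarrow> real) \<Rightarrow> real \<Rightarrow> real" where
  "const_end g t = Sup (connected_component_set (const_set g) t)"

definition gquot :: "(real \<Rightarrow> real) \<Rightarrow> (real \<Rightarrow> 'a::real_normed_field) \<Rightarrow> real \<Rightarrow> real \<Rightarrow> 'a" where
  "gquot g f t s = (f s - f t) / of_real (g s - g t)"

text \<open>The conditions \<open>_ \<noteq> bot\<close> say that the limit can be considered at all for a function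
  whose domain is \<open>[a,b]\<close>.  In particular there is no derivative at \<open>b\<close> if \<open>b\<close> is a jump
  point, nor at \<open>t\<close> in a component of \<open>const_set g\<close> that ends at or beyond \<open>b\<close>.\<close>

definition has_gderiv ::
    "(real \<Rightarrow> real) \<Rightarrow> real \<Rightarrow> real \<Rightarrow> (real \<Rightarrow> 'a::real_normed_field) \<Rightarrow> 'a \<Rightarrow> real \<Rightarrow> bool" where
  "has_gderiv g a b f D t \<longleftrightarrow>
     (if t \<in> jump_set g then
        (let F = at t within {s \<in> {a..b}. t < s \<and> g s \<noteq> g t}
         in F \<noteq> bot \<and> (gquot g f t \<longlongrightarrow> D) F)
      else if t \<in> const_set g then
        bdd_above (connected_component_set (const_set g) t) \<and>
        (let e = const_end g t; F = at e within {s \<in> {a..b}. e < s \<and> g s \<noteq> g e}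
         in F \<noteq> bot \<and> (gquot g f e \<longlongrightarrow> D) F)
      else
        (let F = at t within {s \<in> {a..b}. g s \<noteq> g t}
         in F \<noteq> bot \<and> (gquot g f t \<longlongrightarrow> D) F))"

text \<open>Arbitrary where the derivative does not exist.\<close>

definition gderiv ::
    "(real \<Rightarrow> real) \<Rightarrow> real \<Rightarrow> real \<Rightarrow> (real \<Rightarrow> 'a::real_normed_field) \<Rightarrow> real \<Rightarrow> 'a" where
  "gderiv g a b f t = (THE D. has_gderiv g a b f D t)"

primrec gderivs ::
    "(real \<Rightarrow> real) \<Rightarrow> real \<Rightarrow> real \<Rightarrow> nat \<Rightarrow> (real \<Rightarrow> 'a::real_normed_field) \<Rightarrow> real \<Rightarrow> 'a" where
  "gderivs g a b 0 f = f"
| "gderivs g a b (Suc k) f = gderiv g a b (gderivs g a b k f)"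

definition gdifferentiable_times ::
    "(real \<Rightarrow> real) \<Rightarrow> real \<Rightarrow> real \<Rightarrow> nat \<Rightarrow> (real \<Rightarrow> 'a::real_normed_field) \<Rightarrow> bool" where
  "gdifferentiable_times g a b m f \<longleftrightarrow>
     (\<forall>k<m. \<forall>t\<in>{a..b}. \<exists>D. has_gderiv g a b (gderivs g a b k f) D t)"

definition gabs_continuous ::
    "(real \<Rightarrow> real) \<Rightarrow> real \<Rightarrow> real \<Rightarrow> (real \<Rightarrow> 'a::real_normed_field) \<Rightarrow> bool" where
  "gabs_continuous g a b F \<longleftrightarrow>
     (\<forall>\<epsilon>>0. \<exists>\<delta>>0. \<forall>I :: (real \<times> real) set.
        finite I \<longrightarrow> (\<forall>(c, d)\<in>I. a \<le> c \<and> c < d \<and> d \<le> b) \<longrightarrow>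
        disjoint_family_on (\<lambda>(c, d). {c<..<d}) I \<longrightarrow>
        (\<Sum>(c, d)\<in>I. g d - g c) < \<delta> \<longrightarrow> (\<Sum>(c, d)\<in>I. norm (F d - F c)) < \<epsilon>)"

end

theory Submission
  imports Defs
begin

text \<open>Let \<open>M\<close> be the Stieltjes measure of \<open>g\<close> on \<open>[a,b)\<close> and \<open>J h x\<close> the integral of \<open>h\<close> over
  \<open>[a,x)\<close>.  Iterating the fundamental theorem of calculus \<open>F = F a + J F'\<close> gives a Taylor formula
  \<open>f = p + J\<^sup>n f\<^sup>(\<^sup>n\<^sup>)\<close> with \<open>p\<close> a polynomial of degree less than \<open>n\<close>.  By Fubini, \<open>J\<^sup>n h x\<close> is the
  integral of \<open>h\<close> against an iterated kernel supported on \<open>s < x\<close>, which equals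
  \<open>- K\<^sub>n(x,s) / n!\<close>.  Then \<open>L\<close> kills \<open>p\<close> and commutes with the integral.

  For the fundamental theorem, a \<open>g\<close>-absolutely continuous function is the difference of two
  monotone ones, whose Stieltjes measures are absolutely continuous with respect to \<open>M\<close>; their
  Radon-Nikodym densities give \<open>F = F a + J h\<close>.  That \<open>h\<close> is the \<open>g\<close>-derivative almost everywhere is
  a Lebesgue differentiation theorem for \<open>M\<close>, which needs no Vitali covering argument on the line:
  every finite family of intervals has a subfamily with the same union covering no point more than
  twice.\<close>

section \<open>Chains of intervals and the positive variation\<close>

text \<open>The atoms of the measure shape the details. A \<open>g\<close>-derivative at a jump
  point is a right limit, so the intervals of the differentiation theorem are half-open,
  \<open>[u,v)\<close> with \<open>u \<le> t < v\<close>: they contain the atom at \<open>t\<close>,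
  and \<open>u = t\<close> gives the right quotient. An atom also keeps short intervals that start
  at it from having small mass, so bounded variation is not immediate from absolute continuity. The
  second obstacle is measurability. \<open>gderivs\<close> is a pointwise description, so its
  measurability is not apparent; it is controlled only through the Radon-Nikodym density with which
  it agrees almost everywhere. This is why the final integrals live on a completed measure, and why
  the Taylor formula substitutes under an integral sign. Finally, \<open>L\<close> is linear on
  regulated functions only, so the polynomial and the remainder must both be shown regulated before
  \<open>L\<close> can be applied to their sum.\<close>

text \<open>\<open>chain F g c d r m\<close>: some of the intervals of a partition of \<open>[c,d]\<close> are selected, and over
  these \<open>F\<close> increases by \<open>r\<close> and \<open>g\<close> by \<open>m\<close> in total.  The supremum of all \<open>r\<close> is the positive
  variation of \<open>F\<close>.\<close>

inductive chain :: "(real \<Rightarrow> real) \<Rightarrow> (real \<Rightarrow> real) \<Rightarrow> real \<Rightarrow> real \<Rightarrow> real \<Rightarrow> real \<Rightarrow> bool"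
  for F g where
  start: "chain F g c c 0 0"
| skip: "chain F g c d r m \<Longrightarrow> d < e \<Longrightarrow> chain F g c e r m"
| step: "chain F g c d r m \<Longrightarrow> d < e \<Longrightarrow> chain F g c e (r + (F e - F d)) (m + (g e - g d))"

lemma chain_le: "chain F g c d r m \<Longrightarrow> c \<le> d"
  by (induction rule: chain.induct) auto

lemma chain_skip_le: "chain F g c d r m \<Longrightarrow> d \<le> e \<Longrightarrow> chain F g c e r m"
  by (cases "d = e") (auto intro: chain.skip)

lemma chain_step_le: "chain F g c d r m \<Longrightarrow> d \<le> e \<Longrightarrow> chain F g c e (r + (F e - F d)) (m + (g e - g d))"
  by (cases "d = e") (auto intro: chain.step)

lemma chain_single: "d \<le> e \<Longrightarrow> chain F g d e (F e - F d) (g e - g d)"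
  using chain_step_le[OF chain.start] by simp

lemma chain_append:
  "chain F g d e r' m' \<Longrightarrow> chain F g c d r m \<Longrightarrow> chain F g c e (r + r') (m + m')"
proof (induction rule: chain.induct)
  case (start d)
  then show ?case by simp
next
  case (skip d d' r' m' e)
  then show ?case by (blast intro: chain.skip)
next
  case (step d d' r' m' e)
  then have "chain F g c e (r + r' + (F e - F d')) (m + m' + (g e - g d'))"
    by (blast intro: chain.step)
  then show ?case by (simp add: add.assoc)
qed

text \<open>If \<open>x\<close> falls inside a selected interval, that interval is cut in two and
  its increments of \<open>F\<close> and \<open>g\<close> telescope; inside a skipped interval both
  pieces stay skipped.\<close>

lemma chain_split:
  "chain F g c e r m \<Longrightarrow> c \<le> x \<Longrightarrow> x \<le> e \<Longrightarrow>
    \<exists>r1 m1 r2 m2. chain F g c x r1 m1 \<and> chain F g x e r2 m2 \<and> r = r1 + r2 \<and> m = m1 + m2"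
proof (induction rule: chain.induct)
  case (start c)
  then have "x = c" by simp
  then show ?case using chain.start[of F g c] by force
next
  case (skip c d r m e)
  show ?case
  proof (cases "x \<le> d")
    case True
    then show ?thesis using skip chain.skip by blast
  next
    case False
    then have "chain F g c x r m" "chain F g x e 0 0"
      using skip chain_skip_le[OF chain.start[of F g x], of e] by (auto intro: chain.skip)
    then show ?thesis by force
  qed
next
  case (step c d r m e)
  show ?case
  proof (cases "x \<le> d")
    case True
    then obtain r1 m1 r2 m2 where *: "chain F g c x r1 m1" "chain F g x d r2 m2" "r = r1 + r2" "m = m1 + m2"
      using step by blast
    have "chain F g x e (r2 + (F e - F d)) (m2 + (g e - g d))"
      using *(2) step(2) by (rule chain.step)
    with *(1) show ?thesis unfolding *(3,4) add.assoc by blast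
  next
    case False
    then have "chain F g c x (r + (F x - F d)) (m + (g x - g d))" "chain F g x e (F e - F x) (g e - g x)"
      using step by (auto intro: chain.step chain_single)
    moreover have "r + (F e - F d) = r + (F x - F d) + (F e - F x)"
      "m + (g e - g d) = m + (g x - g d) + (g e - g x)" by simp_all
    ultimately show ?thesis by blast
  qed
qed

lemma chain_mass:
  assumes "mono g"
  shows "chain F g c d r m \<Longrightarrow> 0 \<le> m \<and> m \<le> g d - g c"
proof (induction rule: chain.induct)
  case (start c)
  then show ?case by simp
next
  case (skip c d r m e)
  then show ?case using monoD[OF assms, of d e] by simp
next
  case (step c d r m e)
  then show ?case using monoD[OF assms, of d e] by simp
qed

lemma chain_add:
  "chain (\<lambda>x. F x + G x) g c d r m \<Longrightarrow> \<exists>r1 r2. chain F g c d r1 m \<and> chain G g c d r2 m \<and> r = r1 + r2"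
proof (induction rule: chain.induct)
  case (start c)
  show ?case using chain.start[of F g c] chain.start[of G g c] by force
next
  case (skip c d r m e)
  then show ?case by (blast intro: chain.skip)
next
  case (step c d r m e)
  then obtain r1 r2 where *: "chain F g c d r1 m" "chain G g c d r2 m" "r = r1 + r2" by blast
  have "chain F g c e (r1 + (F e - F d)) (m + (g e - g d))" "chain G g c e (r2 + (G e - G d)) (m + (g e - g d))"
    using * step by (auto intro: chain.step)
  moreover have "r + (F e + G e - (F d + G d)) = (r1 + (F e - F d)) + (r2 + (G e - G d))"
    using * by simp
  ultimately show ?case by blast
qed

text \<open>Translates the inductive chains into the families of disjoint open intervals over which
  \<open>gabs_continuous\<close> quantifies. A new last interval is disjoint from the earlier ones
  because they all end by \<open>d\<close>.\<close>

lemma chain_family: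
  "chain F g c d r m \<Longrightarrow> \<exists>I. finite I \<and> (\<forall>(u, v)\<in>I. c \<le> u \<and> u < v \<and> v \<le> d) \<and>
    disjoint_family_on (\<lambda>(u, v). {u<..<v}) I \<and> (\<Sum>(u, v)\<in>I. g v - g u) = m \<and> (\<Sum>(u, v)\<in>I. F v - F u) = r"
proof (induction rule: chain.induct)
  case (start c)
  show ?case by (intro exI[of _ "{}"]) (auto simp: disjoint_family_on_def)
next
  case (skip c d r m e)
  then obtain I where I: "finite I" "\<forall>(u, v)\<in>I. c \<le> u \<and> u < v \<and> v \<le> d"
      "disjoint_family_on (\<lambda>(u, v). {u<..<v}) I" "(\<Sum>(u, v)\<in>I. g v - g u) = m" "(\<Sum>(u, v)\<in>I. F v - F u) = r"
    by auto
  have "\<forall>(u, v)\<in>I. c \<le> u \<and> u < v \<and> v \<le> e" using I(2) skip(2) by auto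
  with I show ?case by blast
next
  case (step c d r m e)
  then obtain I where I: "finite I" "\<forall>(u, v)\<in>I. c \<le> u \<and> u < v \<and> v \<le> d"
      "disjoint_family_on (\<lambda>(u, v). {u<..<v}) I" "(\<Sum>(u, v)\<in>I. g v - g u) = m" "(\<Sum>(u, v)\<in>I. F v - F u) = r"
    by auto
  have "(d, e) \<notin> I" using I(2) step(2) by auto
  moreover have "\<forall>(u, v)\<in>insert (d, e) I. c \<le> u \<and> u < v \<and> v \<le> e"
    using I(2) step(2) chain_le[OF step(1)] by auto
  moreover have "disjoint_family_on (\<lambda>(u, v). {u<..<v}) (insert (d, e) I)"
  proof -
    have "{d<..<e} \<inter> (\<Union>(u, v)\<in>I. {u<..<v}) = {}" using I(2) by fastforce
    then show ?thesis using I(3) \<open>(d, e) \<notin> I\<close> by (simp add: disjoint_family_on_insert)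
  qed
  ultimately show ?case
    using I by (intro exI[of _ "insert (d, e) I"]) (auto simp: algebra_simps)
qed

text \<open>One-sided: \<open>r\<close> is bounded from above, not in absolute value. This is the
  form that passes to the positive variation; both signs are controlled by assuming it for
  \<open>F\<close> and for \<open>- F\<close>.\<close>

definition chain_ac :: "(real \<Rightarrow> real) \<Rightarrow> real \<Rightarrow> real \<Rightarrow> (real \<Rightarrow> real) \<Rightarrow> bool" where
  "chain_ac g a b F \<longleftrightarrow>
     (\<forall>\<epsilon>>0. \<exists>\<delta>>0. \<forall>c d r m. a \<le> c \<longrightarrow> d \<le> b \<longrightarrow> chain F g c d r m \<longrightarrow> m < \<delta> \<longrightarrow> r < \<epsilon>)"

lemma chain_acD:
  assumes "chain_ac g a b F" "\<epsilon> > 0"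
  obtains \<delta> where "\<delta> > 0" "\<And>c d r m. a \<le> c \<Longrightarrow> d \<le> b \<Longrightarrow> chain F g c d r m \<Longrightarrow> m < \<delta> \<Longrightarrow> r < \<epsilon>"
  using assms unfolding chain_ac_def by meson

lemma gabs_continuous_imp_chain_ac:
  fixes F :: "real \<Rightarrow> real"
  assumes "gabs_continuous g a b F"
  shows "chain_ac g a b F"
  unfolding chain_ac_def
proof (intro allI impI)
  fix \<epsilon> :: real assume "\<epsilon> > 0"
  then obtain \<delta> where "\<delta> > 0" and \<delta>: "\<And>I. \<lbrakk>finite I; \<forall>(c, d)\<in>I. a \<le> c \<and> c < d \<and> d \<le> b;
      disjoint_family_on (\<lambda>(c, d). {c<..<d}) I; (\<Sum>(c, d)\<in>I. g d - g c) < \<delta>\<rbrakk> \<Longrightarrow>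
      (\<Sum>(c, d)\<in>I. norm (F d - F c)) < \<epsilon>"
    using assms unfolding gabs_continuous_def by meson
  have "r < \<epsilon>" if *: "a \<le> c" "d \<le> b" "chain F g c d r m" "m < \<delta>" for c d r m
  proof -
    obtain I where I: "finite I" "\<forall>(u, v)\<in>I. c \<le> u \<and> u < v \<and> v \<le> d"
      "disjoint_family_on (\<lambda>(u, v). {u<..<v}) I" "(\<Sum>(u, v)\<in>I. g v - g u) = m" "(\<Sum>(u, v)\<in>I. F v - F u) = r"
      using chain_family[OF *(3)] by auto
    have "\<forall>(u, v)\<in>I. a \<le> u \<and> u < v \<and> v \<le> b" using I(2) * by fastforce
    then have "(\<Sum>(c, d)\<in>I. norm (F d - F c)) < \<epsilon>"
      using I * by (intro \<delta>) auto
    moreover have "r \<le> (\<Sum>(c, d)\<in>I. norm (F d - F c))"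
      unfolding I(5)[symmetric] by (intro sum_mono) auto
    ultimately show ?thesis by simp
  qed
  with \<open>\<delta> > 0\<close> show "\<exists>\<delta>>0. \<forall>c d r m. a \<le> c \<longrightarrow> d \<le> b \<longrightarrow> chain F g c d r m \<longrightarrow> m < \<delta> \<longrightarrow> r < \<epsilon>"
    by blast
qed

lemma chain_ac_add:
  assumes "chain_ac g a b F" "chain_ac g a b G"
  shows "chain_ac g a b (\<lambda>x. F x + G x)"
  unfolding chain_ac_def
proof (intro allI impI)
  fix \<epsilon> :: real assume "\<epsilon> > 0"
  then have "\<epsilon> / 2 > 0" by simp
  obtain \<delta>1 where 1: "\<delta>1 > 0" "\<And>c d r m. a \<le> c \<Longrightarrow> d \<le> b \<Longrightarrow> chain F g c d r m \<Longrightarrow> m < \<delta>1 \<Longrightarrow> r < \<epsilon> / 2"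
    using chain_acD[OF assms(1) \<open>\<epsilon> / 2 > 0\<close>] by blast
  obtain \<delta>2 where 2: "\<delta>2 > 0" "\<And>c d r m. a \<le> c \<Longrightarrow> d \<le> b \<Longrightarrow> chain G g c d r m \<Longrightarrow> m < \<delta>2 \<Longrightarrow> r < \<epsilon> / 2"
    using chain_acD[OF assms(2) \<open>\<epsilon> / 2 > 0\<close>] by blast
  have "r < \<epsilon>" if *: "a \<le> c" "d \<le> b" "chain (\<lambda>x. F x + G x) g c d r m" "m < min \<delta>1 \<delta>2" for c d r m
  proof -
    obtain r1 r2 where "chain F g c d r1 m" "chain G g c d r2 m" "r = r1 + r2"
      using chain_add[OF *(3)] by blast
    then show ?thesis using 1(2)[OF *(1,2)] 2(2)[OF *(1,2)] *(4) by fastforce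
  qed
  with 1(1) 2(1) show "\<exists>\<delta>>0. \<forall>c d r m. a \<le> c \<longrightarrow> d \<le> b \<longrightarrow>
      chain (\<lambda>x. F x + G x) g c d r m \<longrightarrow> m < \<delta> \<longrightarrow> r < \<epsilon>"
    by (intro exI[of _ "min \<delta>1 \<delta>2"]) auto
qed

text \<open>A jump of \<open>g\<close> at \<open>c\<close> makes the mass of the first interval large however short it is;
  isolating that interval leaves chains of small mass.\<close>

lemma chain_first:
  "chain F g c d r m \<Longrightarrow> r = 0 \<or> (\<exists>y r' m'. c < y \<and> y \<le> d \<and> chain F g y d r' m' \<and> (r = r' \<or> r = r' + (F y - F c)))"
proof (induction rule: chain.induct)
  case (start c)
  then show ?case by simp
next
  case (skip c d r m e)
  from skip.IH show ?case
  proof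
    assume "\<exists>y r' m'. c < y \<and> y \<le> d \<and> chain F g y d r' m' \<and> (r = r' \<or> r = r' + (F y - F c))"
    then obtain y r' m' where y: "c < y" "y \<le> d" "chain F g y d r' m'" "r = r' \<or> r = r' + (F y - F c)"
      by blast
    then have "chain F g y e r' m'" "y \<le> e" using skip(2) by (auto intro: chain.skip)
    with y show ?thesis by blast
  qed simp
next
  case (step c d r m e)
  show ?case
  proof (cases "c = d")
    case True
    have "r = 0"
      using step.IH True by auto
    then show ?thesis
      using step True chain.start[of F g e] by force
  next
    case False
    then have "c < d" using chain_le[OF step(1)] by simp
    show ?thesis
      using step.IH
    proof
      assume "r = 0"
      then show ?thesis
        using \<open>c < d\<close> step(2) chain_single[of d e F g]
        by (intro disjI2 exI[of _ d] exI[of _ "F e - F d"] exI[of _ "g e - g d"]) auto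
    next
      assume "\<exists>y r' m'. c < y \<and> y \<le> d \<and> chain F g y d r' m' \<and> (r = r' \<or> r = r' + (F y - F c))"
      then obtain y r' m' where y: "c < y" "y \<le> d" "chain F g y d r' m'" "r = r' \<or> r = r' + (F y - F c)"
        by blast
      have "chain F g y e (r' + (F e - F d)) (m' + (g e - g d))"
        using y(3) step(2) by (rule chain.step)
      moreover have "r + (F e - F d) = r' + (F e - F d) \<or> r + (F e - F d) = r' + (F e - F d) + (F y - F c)"
        using y(4) by auto
      moreover have "y \<le> e" using y(2) step(2) by simp
      ultimately show ?thesis using y(1) by blast
    qed
  qed
qed

section \<open>Bounded variation and the Jordan decomposition\<close>

lemma mono_at_right_tendsto:
  fixes f :: "real \<Rightarrow> real"
  assumes "mono f"
  shows "\<exists>l. (f \<longlongrightarrow> l) (at_right x)"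
  using Lim_right_bound[of UNIV x f "f x"] assms by (auto simp: mono_def)

lemma mono_at_left_tendsto:
  fixes f :: "real \<Rightarrow> real"
  assumes "mono f"
  shows "\<exists>l. (f \<longlongrightarrow> l) (at_left x)"
  using Lim_left_bound[of UNIV x f "f x"] assms by (auto simp: mono_def)

lemma mono_at_right_Cauchy:
  fixes f :: "real \<Rightarrow> real"
  assumes "mono f" "e > 0"
  shows "\<exists>\<eta>>0. \<forall>u v. x < u \<and> u \<le> v \<and> v < x + \<eta> \<longrightarrow> f v - f u < e"
proof -
  obtain l where "(f \<longlongrightarrow> l) (at_right x)" using mono_at_right_tendsto[OF assms(1)] by blast
  then have "\<forall>\<^sub>F u in at_right x. dist (f u) l < e / 2" using \<open>e > 0\<close> by (intro tendstoD) auto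
  then obtain z where z: "z > x" "\<And>u. x < u \<Longrightarrow> u < z \<Longrightarrow> dist (f u) l < e / 2"
    by (auto simp: eventually_at_right[of x "x + 1"])
  have "f v - f u < e" if "x < u" "u \<le> v" "v < x + (z - x)" for u v
    using z(2)[of u] z(2)[of v] that by (auto simp: dist_real_def abs_real_def split: if_splits)
  with z(1) show ?thesis by (intro exI[of _ "z - x"]) auto
qed

lemma derivator_at_left_Cauchy:
  assumes "derivator f" "e > 0"
  shows "\<exists>\<eta>>0. \<forall>u. x - \<eta> < u \<and> u \<le> x \<longrightarrow> f x - f u < e"
proof -
  have "(f \<longlongrightarrow> f x) (at_left x)" using assms(1) by (auto simp: derivator_def continuous_within)
  then have "\<forall>\<^sub>F u in at_left x. dist (f u) (f x) < e" using \<open>e > 0\<close> by (auto dest: tendstoD)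
  then obtain z where z: "z < x" "\<And>u. z < u \<Longrightarrow> u < x \<Longrightarrow> dist (f u) (f x) < e"
    by (auto simp: eventually_at_left[of "x - 1" x])
  have "f x - f u < e" if "x - (x - z) < u" "u \<le> x" for u
    using z(2)[of u] that \<open>e > 0\<close> by (cases "u = x") (auto simp: dist_real_def abs_real_def split: if_splits)
  with z(1) show ?thesis by (intro exI[of _ "x - z"]) auto
qed

text \<open>Compactness by bisection: it is enough to bound the chains over short intervals around
  each point \<open>x\<close>. To the left of \<open>x\<close>, left continuity of \<open>g\<close>
  keeps the mass small. To the right a jump may prevent this, but only an interval that starts at
  \<open>x\<close> sees the jump, and its increment is bounded separately.\<close>

lemma chain_ac_bounded_variation:
  assumes g: "derivator g" and "a \<le> b" and ac: "chain_ac g a b F" "chain_ac g a b (\<lambda>x. - F x)"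
  shows "\<exists>B. \<forall>r m. chain F g a b r m \<longrightarrow> r \<le> B"
proof -
  have "mono g" using g by (simp add: derivator_def)
  define P where "P c d \<longleftrightarrow> (a \<le> c \<longrightarrow> d \<le> b \<longrightarrow> (\<exists>B. \<forall>r m. chain F g c d r m \<longrightarrow> r \<le> B))" for c d
  have "P a b"
    using \<open>a \<le> b\<close>
  proof (rule Bolzano)
    fix c x d assume *: "P c x" "P x d" "c \<le> x" "x \<le> d"
    show "P c d"
      unfolding P_def
    proof (intro impI)
      assume "a \<le> c" "d \<le> b"
      then obtain B1 B2 where B: "\<And>r m. chain F g c x r m \<Longrightarrow> r \<le> B1" "\<And>r m. chain F g x d r m \<Longrightarrow> r \<le> B2"
        using * unfolding P_def by (meson order_trans)
      have "r \<le> B1 + B2" if "chain F g c d r m" for r m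
        using chain_split[OF that *(3,4)] B by (auto intro: add_mono)
      then show "\<exists>B. \<forall>r m. chain F g c d r m \<longrightarrow> r \<le> B" by blast
    qed
  next
    fix x assume x: "a \<le> x" "x \<le> b"
    obtain \<delta>1 where 1: "\<delta>1 > 0" "\<And>c d r m. a \<le> c \<Longrightarrow> d \<le> b \<Longrightarrow> chain F g c d r m \<Longrightarrow> m < \<delta>1 \<Longrightarrow> r < 1"
      using chain_acD[OF ac(1), of 1] by auto
    obtain \<delta>2 where 2: "\<delta>2 > 0" "\<And>c d r m. a \<le> c \<Longrightarrow> d \<le> b \<Longrightarrow> chain (\<lambda>x. - F x) g c d r m \<Longrightarrow> m < \<delta>2 \<Longrightarrow> r < 1"
      using chain_acD[OF ac(2), of 1] by auto
    define \<delta> where "\<delta> = min \<delta>1 \<delta>2"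
    have "\<delta> > 0" using 1 2 by (simp add: \<delta>_def)
    obtain \<eta>1 where \<eta>1: "\<eta>1 > 0" "\<And>u. x - \<eta>1 < u \<Longrightarrow> u \<le> x \<Longrightarrow> g x - g u < \<delta>"
      using derivator_at_left_Cauchy[OF g \<open>\<delta> > 0\<close>, of x] by blast
    obtain \<eta>2 where \<eta>2: "\<eta>2 > 0" "\<And>u v. x < u \<Longrightarrow> u \<le> v \<Longrightarrow> v < x + \<eta>2 \<Longrightarrow> g v - g u < \<delta>"
      using mono_at_right_Cauchy[OF \<open>mono g\<close> \<open>\<delta> > 0\<close>, of x] by blast
    have "P u v" if uv: "u \<le> x" "x \<le> v" "v - u < min \<eta>1 \<eta>2" for u v
      unfolding P_def
    proof (intro impI)
      assume ab: "a \<le> u" "v \<le> b"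
      have "r \<le> 1 + (\<bar>F v - F x\<bar> + 2)" if r: "chain F g u v r m" for r m
      proof -
        obtain r1 m1 r2 m2 where s: "chain F g u x r1 m1" "chain F g x v r2 m2" "r = r1 + r2"
          using chain_split[OF r uv(1,2)] by blast
        have "g x - g u < \<delta>" using uv \<eta>1(1) by (intro \<eta>1(2)) auto
        then have "m1 < \<delta>1" using chain_mass[OF \<open>mono g\<close> s(1)] by (simp add: \<delta>_def)
        then have "r1 < 1" using 1(2)[OF ab(1) _ s(1)] x(2) by simp
        \<comment> \<open>The interval from \<open>x\<close> to \<open>y\<close> contributes
          \<open>F y - F x = (F v - F x) + (F y - F v)\<close>. The first term is fixed by
          \<open>v\<close>; the second is below 1 by absolute continuity of \<open>- F\<close> on
          \<open>[y,v]\<close>, whose mass avoids the jump at \<open>x\<close>. The rest of the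
          chain adds at most another 1.\<close>
        moreover have "r2 \<le> \<bar>F v - F x\<bar> + 2"
        proof (cases "r2 = 0")
          case False
          then obtain y r' m' where y: "x < y" "y \<le> v" "chain F g y v r' m'" "r2 = r' \<or> r2 = r' + (F y - F x)"
            using chain_first[OF s(2)] by blast
          have gy: "g v - g y < \<delta>" using uv y \<eta>2(1) by (intro \<eta>2(2)) auto
          then have "m' < \<delta>1" using chain_mass[OF \<open>mono g\<close> y(3)] by (simp add: \<delta>_def)
          then have "r' < 1" using 1(2)[OF _ ab(2) y(3)] x(1) y(1) by simp
          moreover have "- F v - - F y < 1"
            using gy x(1) y(1) by (intro 2(2)[OF _ ab(2) chain_single[OF y(2)]]) (auto simp: \<delta>_def)
          ultimately show ?thesis using y(4) by auto
        qed simp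
        ultimately show ?thesis using s(3) by simp
      qed
      then show "\<exists>B. \<forall>r m. chain F g u v r m \<longrightarrow> r \<le> B" by blast
    qed
    then show "\<exists>d>0. \<forall>u v. u \<le> x \<and> x \<le> v \<and> v - u < d \<longrightarrow> P u v"
      using \<eta>1(1) \<eta>2(1) by (intro exI[of _ "min \<eta>1 \<eta>2"]) auto
  qed
  then show ?thesis by (simp add: P_def)
qed

text \<open>\<open>P\<close> is the positive variation and \<open>N = P - F\<close>. A chain of
  \<open>P\<close> can be replaced, up to a small error, by a chain of \<open>F\<close> of no larger
  mass, so \<open>P\<close> inherits absolute continuity; \<open>N\<close> is then a sum of
  \<open>P\<close> and \<open>- F\<close>.\<close>

lemma chain_ac_monotone_decomposition:
  assumes g: "derivator g" and "a \<le> b" and ac: "chain_ac g a b F" "chain_ac g a b (\<lambda>x. - F x)"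
  obtains P N where "mono_on {a..b} P" "mono_on {a..b} N" "chain_ac g a b P" "chain_ac g a b N"
    "\<And>x. F x = P x - N x"
proof -
  obtain B where B: "\<And>r m. chain F g a b r m \<Longrightarrow> r \<le> B"
    using chain_ac_bounded_variation[OF assms] by blast
  define P where "P x = Sup {r. \<exists>m. chain F g a x r m}" for x
  have bdd: "bdd_above {r. \<exists>m. chain F g a x r m}" if "x \<le> b" for x
    using B chain_skip_le[OF _ that, of F g a] unfolding bdd_above_def by blast
  have upper: "r \<le> P x" if "chain F g a x r m" "x \<le> b" for x r m
    unfolding P_def using that bdd by (intro cSup_upper) auto
  \<comment> \<open>A nearly optimal chain up to \<open>y\<close> is cut at \<open>x\<close>: its
    first part contributes at most \<open>P x\<close>, so its second part nearly realises
    \<open>P y - P x\<close>.\<close>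
  have approx: "\<exists>r m. chain F g x y r m \<and> P y - P x < r + \<eta>" if xy: "a \<le> x" "x \<le> y" "y \<le> b" "\<eta> > 0" for x y \<eta>
  proof -
    have "{r. \<exists>m. chain F g a y r m} \<noteq> {}"
      using chain_single[of a y F g] that by auto
    moreover have "P y - \<eta> < Sup {r. \<exists>m. chain F g a y r m}"
      using \<open>\<eta> > 0\<close> by (simp add: P_def)
    ultimately obtain r where "r \<in> {r. \<exists>m. chain F g a y r m}" and r2: "P y - \<eta> < r"
      using less_cSupE[of "P y - \<eta>" "{r. \<exists>m. chain F g a y r m}"] by blast
    then obtain m where r: "chain F g a y r m" by blast
    obtain r1 m1 r' m' where s: "chain F g a x r1 m1" "chain F g x y r' m'" "r = r1 + r'"
      using chain_split[OF r xy(1,2)] by blast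
    have "r1 \<le> P x" using s(1) that by (intro upper) auto
    with s r2 show ?thesis by (intro exI[of _ r'] exI[of _ m']) auto
  qed
  have inc: "P x + (F y - F x) \<le> P y" "P x \<le> P y" if "a \<le> x" "x \<le> y" "y \<le> b" for x y
  proof -
    have ne: "{r. \<exists>m. chain F g a x r m} \<noteq> {}" using chain_single[of a x F g] that by auto
    have "P x \<le> P y - (F y - F x)"
      unfolding P_def[of x]
    proof (rule cSup_least[OF ne])
      fix r assume "r \<in> {r. \<exists>m. chain F g a x r m}"
      then obtain m where "chain F g a x r m" by blast
      then have "r + (F y - F x) \<le> P y" using that by (intro upper[OF chain_step_le]) auto
      then show "r \<le> P y - (F y - F x)" by simp
    qed
    then show "P x + (F y - F x) \<le> P y" by simp
    show "P x \<le> P y"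
      unfolding P_def[of x]
    proof (rule cSup_least[OF ne])
      fix r assume "r \<in> {r. \<exists>m. chain F g a x r m}"
      then obtain m where "chain F g a x r m" by blast
      then show "r \<le> P y" using that by (intro upper[OF chain_skip_le]) auto
    qed
  qed
  \<comment> \<open>The error \<open>\<eta>\<close> is arbitrary in the induction, so each step can
    leave half of it to the earlier intervals and spend the other half on the new one.\<close>
  have chain_P: "chain P g c d r m \<Longrightarrow> a \<le> c \<Longrightarrow> d \<le> b \<Longrightarrow> \<eta> > 0 \<Longrightarrow>
      \<exists>r' m'. chain F g c d r' m' \<and> m' \<le> m \<and> r < r' + \<eta>" for c d r m \<eta>
  proof (induction arbitrary: \<eta> rule: chain.induct)
    case (start c)
    then show ?case using chain.start[of F g c] by force
  next
    case (skip c d r m e)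
    then obtain r' m' where "chain F g c d r' m'" "m' \<le> m" "r < r' + \<eta>"
      by (metis less_imp_le order_trans)
    then show ?case using chain.skip[OF _ skip(2)] by blast
  next
    case (step c d r m e)
    have "\<eta> / 2 > 0" "d \<le> b" using step by auto
    then obtain r' m' where 1: "chain F g c d r' m'" "m' \<le> m" "r < r' + \<eta> / 2"
      using step.IH[OF step.prems(1)] by blast
    obtain r2 m2 where 2: "chain F g d e r2 m2" "P e - P d < r2 + \<eta> / 2"
      using approx[of d e "\<eta> / 2"] step chain_le[OF step(1)] \<open>\<eta> / 2 > 0\<close> by auto
    have "m2 \<le> g e - g d" using chain_mass[OF _ 2(1)] g by (auto simp: derivator_def)
    with 1 2 chain_append[OF 2(1) 1(1)] show ?case
      by (intro exI[of _ "r' + r2"] exI[of _ "m' + m2"]) auto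
  qed
  have acP: "chain_ac g a b P"
    unfolding chain_ac_def
  proof (intro allI impI)
    fix \<epsilon> :: real assume "\<epsilon> > 0"
    then have "\<epsilon> / 2 > 0" by simp
    then obtain \<delta> where \<delta>: "\<delta> > 0" "\<And>c d r m. a \<le> c \<Longrightarrow> d \<le> b \<Longrightarrow> chain F g c d r m \<Longrightarrow> m < \<delta> \<Longrightarrow> r < \<epsilon> / 2"
      using chain_acD[OF ac(1)] by blast
    have "r < \<epsilon>" if *: "a \<le> c" "d \<le> b" "chain P g c d r m" "m < \<delta>" for c d r m
    proof -
      obtain r' m' where "chain F g c d r' m'" "m' \<le> m" "r < r' + \<epsilon> / 2"
        using chain_P[OF *(3,1,2) \<open>\<epsilon> / 2 > 0\<close>] by blast
      moreover have "r' < \<epsilon> / 2" using \<delta>(2)[OF *(1,2)] calculation(1,2) *(4) by (meson le_less_trans)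
      ultimately show ?thesis by simp
    qed
    with \<delta>(1) show "\<exists>\<delta>>0. \<forall>c d r m. a \<le> c \<longrightarrow> d \<le> b \<longrightarrow> chain P g c d r m \<longrightarrow> m < \<delta> \<longrightarrow> r < \<epsilon>"
      by blast
  qed
  show ?thesis
  proof (rule that[of P "\<lambda>x. P x + - F x"])
    show "mono_on {a..b} P" using inc(2) by (auto simp: mono_on_def)
    show "mono_on {a..b} (\<lambda>x. P x + - F x)" using inc(1) by (fastforce simp: mono_on_def)
    show "chain_ac g a b (\<lambda>x. P x + - F x)" using acP ac(2) by (rule chain_ac_add)
  qed (use acP in auto)
qed

section \<open>Absolutely continuous functions are integrals\<close>

text \<open>The uncompleted measure: Fubini and the regularity theorems are available for Borel measures.\<close>

definition borel_stieltjes :: "(real \<Rightarrow> real) \<Rightarrow> real measure" where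
  "borel_stieltjes g = distr (interval_measure (\<lambda>t. - g (- t))) borel uminus"

text \<open>A density instead of a restricted space: this stays a Borel measure on the whole line,
  to which the regularity theorems, Fubini and integrals over the line apply directly, while its
  total mass is finite.\<close>

definition stieltjes_on :: "(real \<Rightarrow> real) \<Rightarrow> real \<Rightarrow> real \<Rightarrow> real measure" where
  "stieltjes_on g a b = density (borel_stieltjes g) (indicator {a..<b})"

lemma sets_borel_stieltjes [simp, measurable_cong]: "sets (borel_stieltjes g) = sets borel"
  by (simp add: borel_stieltjes_def)

lemma sets_stieltjes_on [simp, measurable_cong]: "sets (stieltjes_on g a b) = sets borel"
  by (simp add: stieltjes_on_def)

lemma space_stieltjes_on [simp]: "space (stieltjes_on g a b) = UNIV"
  by (simp add: stieltjes_on_def borel_stieltjes_def)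

lemma stieltjes_eq: "stieltjes g = completion (borel_stieltjes g)"
  by (simp add: stieltjes_def borel_stieltjes_def)

lemma emeasure_borel_stieltjes_Ico:
  "derivator g \<Longrightarrow> c \<le> d \<Longrightarrow> emeasure (borel_stieltjes g) {c..<d} = ennreal (g d - g c)"
  using emeasure_stieltjes_Ico[of g c d] by (simp add: stieltjes_eq)

lemma emeasure_stieltjes_on: "A \<in> sets borel \<Longrightarrow> emeasure (stieltjes_on g a b) A = emeasure (borel_stieltjes g) (A \<inter> {a..<b})"
  unfolding stieltjes_on_def by (subst emeasure_density) (simp_all flip: indicator_inter_arith add: Int_commute)

lemma emeasure_stieltjes_on_Ico:
  assumes "derivator g" "a \<le> c" "c \<le> d" "d \<le> b"
  shows "emeasure (stieltjes_on g a b) {c..<d} = ennreal (g d - g c)"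
proof -
  have "{c..<d} \<inter> {a..<b} = {c..<d}" using assms by auto
  then show ?thesis using assms by (simp add: emeasure_stieltjes_on emeasure_borel_stieltjes_Ico)
qed

lemma finite_measure_stieltjes_on:
  assumes "derivator g"
  shows "finite_measure (stieltjes_on g a b)"
proof (cases "a \<le> b")
  case True
  then show ?thesis
    using emeasure_borel_stieltjes_Ico[OF assms True] by (intro finite_measureI) (simp add: emeasure_stieltjes_on)
next
  case False
  then show ?thesis by (intro finite_measureI) (simp add: emeasure_stieltjes_on)
qed

lemma measure_stieltjes_on_Ico:
  assumes "derivator g" "a \<le> c" "c \<le> d" "d \<le> b"
  shows "measure (stieltjes_on g a b) {c..<d} = g d - g c"
  using assms by (simp add: measure_def emeasure_stieltjes_on_Ico derivator_def mono_def)

lemma AE_stieltjes_on: "(AE x in stieltjes_on g a b. P x) \<longleftrightarrow> (AE x in borel_stieltjes g. x \<in> {a..<b} \<longrightarrow> P x)"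
  unfolding stieltjes_on_def by (subst AE_density) (auto simp: indicator_def)

lemma AE_stieltjes_on_range: "AE x in stieltjes_on g a b. x \<in> {a..<b}"
  by (simp add: AE_stieltjes_on)

section \<open>Absolute continuity between Stieltjes measures\<close>

lemma grid_cell_exists:
  fixes a b x :: real
  assumes "a \<le> x" "x < b" "n > 0"
  shows "\<exists>i<n. a + real i * ((b - a) / real n) \<le> x \<and> x < a + real (Suc i) * ((b - a) / real n)"
proof -
  define w where "w = (b - a) / real n"
  have "w > 0" using assms by (simp add: w_def)
  define i where "i = nat \<lfloor>(x - a) / w\<rfloor>"
  have ge: "0 \<le> (x - a) / w" using assms \<open>w > 0\<close> by simp
  then have i: "real i \<le> (x - a) / w" "(x - a) / w < real i + 1"
    unfolding i_def by (simp_all add: of_nat_floor)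
  have "(x - a) / w < real n"
    using assms \<open>w > 0\<close> by (simp add: w_def field_simps)
  then have "i < n" using i by linarith
  moreover have "a + real i * w \<le> x" "x < a + real (Suc i) * w"
    using i \<open>w > 0\<close> by (simp_all add: field_simps)
  ultimately show ?thesis by (auto simp: w_def)
qed

text \<open>Inner regularity reduces a null set to its compact subsets \<open>K\<close>, and outer
  regularity puts \<open>K\<close> into an open \<open>U\<close> of small mass. By compactness some
  \<open>e\<close> is such that every \<open>e\<close>-ball around a point of \<open>K\<close> lies
  in \<open>U\<close>; hence the cells of a grid finer than \<open>e\<close> that lie in
  \<open>U\<close> cover \<open>K\<close>, and they form a chain of small mass.\<close>

lemma absolutely_continuous_stieltjes_on:
  assumes g: "derivator g" and Q: "derivator Q" and "a < b" and ac: "chain_ac g a b Q"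
  shows "absolutely_continuous (stieltjes_on g a b) (stieltjes_on Q a b)"
proof -
  let ?M = "stieltjes_on g a b" and ?N = "stieltjes_on Q a b"
  interpret M: finite_measure ?M by (rule finite_measure_stieltjes_on[OF g])
  interpret N: finite_measure ?N by (rule finite_measure_stieltjes_on[OF Q])
  have small: "measure ?N K \<le> \<epsilon>" if K: "compact K" "K \<subseteq> {a..<b}" "emeasure ?M K = 0" and "\<epsilon> > 0" for K \<epsilon>
  proof -
    obtain \<delta> where \<delta>: "\<delta> > 0" "\<And>c d r m. a \<le> c \<Longrightarrow> d \<le> b \<Longrightarrow> chain Q g c d r m \<Longrightarrow> m < \<delta> \<Longrightarrow> r < \<epsilon>"
      using chain_acD[OF ac \<open>\<epsilon> > 0\<close>] by blast
    have "(INF U \<in> {U. K \<subseteq> U \<and> open U}. emeasure ?M U) < ennreal \<delta>"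
      using K \<delta>(1) outer_regular[of ?M K] by (simp add: M.emeasure_finite compact_imp_closed)
    then obtain U where U: "K \<subseteq> U" "open U" "emeasure ?M U < ennreal \<delta>"
      by (auto simp: INF_less_iff)
    then have U\<delta>: "measure ?M U < \<delta>"
      using \<delta>(1) by (simp add: M.emeasure_eq_measure ennreal_less_iff)
    obtain e where e: "e > 0" "(\<Union>x\<in>K. ball x e) \<subseteq> U"
      using compact_subset_open_imp_ball_epsilon_subset[OF K(1) U(2,1)] by blast
    obtain n :: nat where "n > 0" and n: "(b - a) / real n < e"
    proof -
      obtain n :: nat where "(b - a) / e < real n" using reals_Archimedean2 by blast
      moreover from this have "n > 0" using \<open>a < b\<close> e(1)
        by (metis diff_gt_0_iff_gt divide_pos_pos gr0I less_asym of_nat_0)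
      ultimately show ?thesis using that[of n] e(1) by (simp add: field_simps)
    qed
    define w where "w = (b - a) / real n"
    define p where "p i = a + real i * w" for i :: nat
    have "w > 0" using \<open>a < b\<close> \<open>n > 0\<close> by (simp add: w_def)
    have p: "p 0 = a" "p n = b" "p (Suc i) = p i + w" "a \<le> p i" for i
    proof -
      show "p n = b" using \<open>n > 0\<close> by (simp add: p_def w_def)
    qed (use \<open>w > 0\<close> in \<open>simp_all add: p_def algebra_simps\<close>)
    have pn: "p i \<le> b" if "i \<le> n" for i
    proof -
      have "real i * w \<le> real n * w" using that \<open>w > 0\<close> by (intro mult_right_mono) auto
      then show ?thesis using p(2) by (simp add: p_def)
    qed
    \<comment> \<open>Every cell inside \<open>U\<close> is selected, whether or not it meets
      \<open>K\<close>. The selected union then has mass below \<open>\<delta>\<close> simply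
      because it lies in \<open>U\<close>.\<close>
    define C where "C i = (if {p i..<p (Suc i)} \<subseteq> U then {p i..<p (Suc i)} else {})" for i
    define A where "A j = (\<Union>i<j. C i)" for j
    have [measurable]: "A j \<in> sets borel" for j unfolding A_def C_def by (intro sets.finite_UN) auto
    have A_less: "A j \<subseteq> {a..<p j}" for j
    proof (induction j)
      case (Suc j)
      then show ?case using p(4)[of j] p(3)[of j] \<open>w > 0\<close> by (fastforce simp: A_def C_def lessThan_Suc)
    qed (simp add: A_def)
    have ch: "j \<le> n \<Longrightarrow> chain Q g a (p j) (measure ?N (A j)) (measure ?M (A j))" for j
    proof (induction j)
      case 0
      then show ?case by (simp add: A_def p chain.start)
    next
      case (Suc j)
      have lt: "p j < p (Suc j)" using p(3)[of j] \<open>w > 0\<close> by simp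
      show ?case
      proof (cases "{p j..<p (Suc j)} \<subseteq> U")
        case True
        then have A: "A (Suc j) = A j \<union> {p j..<p (Suc j)}" by (auto simp: A_def C_def lessThan_Suc)
        have disj: "A j \<inter> {p j..<p (Suc j)} = {}" using A_less[of j] by auto
        have "measure ?N (A (Suc j)) = measure ?N (A j) + (Q (p (Suc j)) - Q (p j))"
          "measure ?M (A (Suc j)) = measure ?M (A j) + (g (p (Suc j)) - g (p j))"
          unfolding A using disj p(4) pn[OF Suc.prems] lt g Q
          by (simp_all add: N.finite_measure_Union M.finite_measure_Union measure_stieltjes_on_Ico)
        then show ?thesis using chain.step[OF Suc.IH lt] Suc.prems by simp
      next
        case False
        then have "A (Suc j) = A j" by (auto simp: A_def C_def lessThan_Suc)
        then show ?thesis using chain.skip[OF Suc.IH lt] Suc.prems by simp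
      qed
    qed
    have "A n \<subseteq> U" by (auto simp: A_def C_def split: if_splits)
    then have "measure ?M (A n) < \<delta>"
      using U\<delta> U(2) M.finite_measure_mono[of "A n" U] by simp
    then have "measure ?N (A n) < \<epsilon>"
      using \<delta>(2)[OF _ _ ch[of n]] p(2) by simp
    moreover have "K \<subseteq> A n"
    proof
      fix x assume "x \<in> K"
      then have "a \<le> x" "x < b" using K(2) by auto
      then obtain i where i: "i < n" "p i \<le> x" "x < p (Suc i)"
        using grid_cell_exists[OF _ _ \<open>n > 0\<close>, of a x b] unfolding p_def w_def by blast
      have "{p i..<p (Suc i)} \<subseteq> ball x e"
        using i n p(3)[of i] by (auto simp: dist_real_def w_def)
      then have "{p i..<p (Suc i)} \<subseteq> U" using e(2) \<open>x \<in> K\<close> by blast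
      then show "x \<in> A n" using i by (auto simp: A_def C_def)
    qed
    ultimately show ?thesis
      using N.finite_measure_mono[of K "A n"] by simp
  qed
  show ?thesis
    unfolding absolutely_continuous_def
  proof
    fix S assume S: "S \<in> null_sets ?M"
    then have Sb: "S \<in> sets borel" by auto
    have "emeasure ?N (S \<inter> {a..<b}) = (SUP K \<in> {K. K \<subseteq> S \<inter> {a..<b} \<and> compact K}. emeasure ?N K)"
      using Sb by (intro inner_regular) (auto simp: N.emeasure_finite)
    also have "\<dots> \<le> 0"
    proof (rule SUP_least)
      fix K assume "K \<in> {K. K \<subseteq> S \<inter> {a..<b} \<and> compact K}"
      then have K: "K \<subseteq> S" "K \<subseteq> {a..<b}" "compact K" by auto
      then have "K \<in> sets ?M" by (simp add: compact_imp_closed)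
      with S K(1) have "emeasure ?M K = 0"
        by (meson null_setsD1 null_sets_subset)
      then have "measure ?N K \<le> 0"
        using small[OF K(3,2)] by (meson field_le_epsilon dual_order.trans add_increasing order_refl)
      then show "emeasure ?N K \<le> 0" by (simp add: N.emeasure_eq_measure measure_le_0_iff)
    qed
    finally have "emeasure ?N S = 0"
      using Sb by (simp add: emeasure_stieltjes_on Int_assoc)
    then show "S \<in> null_sets ?N" using Sb by auto
  qed
qed

text \<open>Continued by constants outside \<open>[a,b]\<close>, \<open>P\<close> becomes a
  derivator \<open>Q\<close>: its left continuity comes from that of \<open>g\<close>, since short
  intervals ending at \<open>x\<close> have small mass. The integrand is the Radon-Nikodym density
  of the measure of \<open>Q\<close>, which is finite almost everywhere.\<close>

lemma chain_ac_mono_integral: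
  assumes g: "derivator g" and "a < b" and P: "mono_on {a..b} P" and ac: "chain_ac g a b P"
  shows "\<exists>h. integrable (stieltjes_on g a b) h \<and> (\<forall>x\<in>{a..b}. P x = P a + (LINT t:{a..<x}|stieltjes_on g a b. h t))"
proof -
  let ?M = "stieltjes_on g a b"
  interpret M: finite_measure ?M by (rule finite_measure_stieltjes_on[OF g])
  define Q where "Q x = P (max a (min x b))" for x
  have QP: "Q x = P x" if "x \<in> {a..b}" for x
    using that by (simp add: Q_def max_def min_def)
  have "mono Q"
  proof (rule monoI)
    fix x y :: real assume "x \<le> y"
    then show "Q x \<le> Q y" unfolding Q_def using \<open>a < b\<close> by (intro mono_onD[OF P]) auto
  qed
  have chainQ: "chain Q g c d r m \<Longrightarrow> a \<le> c \<Longrightarrow> d \<le> b \<Longrightarrow> chain P g c d r m" for c d r m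
  proof (induction rule: chain.induct)
    case (start c)
    show ?case by (rule chain.start)
  next
    case (skip c d r m e)
    then show ?case by (auto intro: chain.skip)
  next
    case (step c d r m e)
    then have "Q e - Q d = P e - P d" using chain_le[OF step(1)] by (simp add: QP)
    then show ?case using step chain.step[of P g c d r m e] by simp
  qed
  have acQ: "chain_ac g a b Q"
    using ac chainQ unfolding chain_ac_def by meson
  have "continuous (at_left x) Q" for x
    unfolding continuous_within
  proof (cases "a < x \<and> x \<le> b")
    case False
    have "\<forall>\<^sub>F u in at_left x. Q u = Q x"
    proof (cases "x \<le> a")
      case True
      have "\<forall>\<^sub>F u in at_left x. u < x" by (simp add: eventually_at_filter)
      then show ?thesis by eventually_elim (use True in \<open>simp add: Q_def\<close>)
    next
      case False': False
      then have "\<forall>\<^sub>F u in at_left x. b < u" using False by (intro eventually_at_leftI[of b]) auto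
      then show ?thesis by eventually_elim (use False False' in \<open>simp add: Q_def\<close>)
    qed
    then show "(Q \<longlongrightarrow> Q x) (at_left x)" by (rule tendsto_eventually)
  next
    case True
    show "(Q \<longlongrightarrow> Q x) (at_left x)"
    proof (rule tendstoI)
      fix e :: real assume "e > 0"
      obtain \<delta> where \<delta>: "\<delta> > 0" "\<And>c d r m. a \<le> c \<Longrightarrow> d \<le> b \<Longrightarrow> chain Q g c d r m \<Longrightarrow> m < \<delta> \<Longrightarrow> r < e"
        using chain_acD[OF acQ \<open>e > 0\<close>] by blast
      obtain \<eta> where \<eta>: "\<eta> > 0" "\<And>u. x - \<eta> < u \<Longrightarrow> u \<le> x \<Longrightarrow> g x - g u < \<delta>"
        using derivator_at_left_Cauchy[OF g \<delta>(1), of x] by blast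
      have "dist (Q u) (Q x) < e" if "max a (x - \<eta>) < u" "u < x" for u
      proof -
        have "Q x - Q u < e"
          using \<eta>(2)[of u] that True by (intro \<delta>(2)[OF _ _ chain_single]) auto
        then show ?thesis using monoD[OF \<open>mono Q\<close>, of u x] that by (simp add: dist_real_def)
      qed
      then show "\<forall>\<^sub>F u in at_left x. dist (Q u) (Q x) < e"
        using True \<eta>(1) by (intro eventually_at_leftI[of "max a (x - \<eta>)"]) auto
    qed
  qed
  with \<open>mono Q\<close> have Q: "derivator Q" by (simp add: derivator_def)
  let ?N = "stieltjes_on Q a b"
  obtain f where f [measurable]: "f \<in> borel_measurable ?M" and N: "density ?M f = ?N"
    using M.Radon_Nikodym[OF absolutely_continuous_stieltjes_on[OF g Q \<open>a < b\<close> acQ]] by auto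
  have meas: "(\<integral>\<^sup>+t. f t * indicator A t \<partial>?M) = emeasure ?N A" if "A \<in> sets borel" for A
    unfolding N[symmetric] using that by (subst emeasure_density) auto
  have "(\<integral>\<^sup>+t. f t \<partial>?M) \<noteq> \<infinity>"
    using meas[of UNIV] finite_measure.emeasure_finite[OF finite_measure_stieltjes_on[OF Q, of a b]] by simp
  then have fin: "AE t in ?M. f t \<noteq> \<infinity>"
    by (rule nn_integral_PInf_AE[OF f])
  define h where "h t = enn2real (f t)" for t
  have hf: "AE t in ?M. ennreal (h t) = f t"
    using fin by eventually_elim (simp add: h_def ennreal_enn2real_if)
  have [measurable]: "h \<in> borel_measurable ?M" unfolding h_def by measurable
  have ih: "integrable ?M h"
  proof (rule integrableI_nonneg)
    have "(\<integral>\<^sup>+t. ennreal (h t) \<partial>?M) = (\<integral>\<^sup>+t. f t \<partial>?M)"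
      using hf by (intro nn_integral_cong_AE) auto
    then show "(\<integral>\<^sup>+t. ennreal (h t) \<partial>?M) < \<infinity>"
      using \<open>(\<integral>\<^sup>+t. f t \<partial>?M) \<noteq> \<infinity>\<close> by (simp add: less_top)
  qed (auto simp: h_def)
  have "P x = P a + (LINT t:{a..<x}|?M. h t)" if x: "x \<in> {a..b}" for x
  proof -
    have i: "integrable ?M (\<lambda>t. indicator {a..<x} t * h t)"
      using integrable_mult_indicator[OF _ ih, of "{a..<x}"] by simp
    have "ennreal (LINT t:{a..<x}|?M. h t) = (\<integral>\<^sup>+t. ennreal (indicator {a..<x} t * h t) \<partial>?M)"
      unfolding set_lebesgue_integral_def real_scaleR_def
      using i by (intro nn_integral_eq_integral[symmetric]) (auto simp: h_def)
    also have "\<dots> = (\<integral>\<^sup>+t. f t * indicator {a..<x} t \<partial>?M)"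
      using hf by (intro nn_integral_cong_AE) (auto elim!: eventually_mono simp: indicator_def)
    also have "\<dots> = ennreal (Q x - Q a)"
      using x Q by (simp add: meas emeasure_stieltjes_on_Ico)
    finally have "(LINT t:{a..<x}|?M. h t) = Q x - Q a"
      using monoD[OF \<open>mono Q\<close>, of a x] x
      by (subst (asm) ennreal_inj) (auto simp: set_lebesgue_integral_def h_def intro!: Bochner_Integration.integral_nonneg)
    then show ?thesis using x by (simp add: QP)
  qed
  with ih show ?thesis by blast
qed

lemma gabs_continuous_integral:
  fixes F :: "real \<Rightarrow> real"
  assumes g: "derivator g" and "a < b" and F: "gabs_continuous g a b F"
  shows "\<exists>h. integrable (stieltjes_on g a b) h \<and> (\<forall>x\<in>{a..b}. F x = F a + (LINT t:{a..<x}|stieltjes_on g a b. h t))"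
proof -
  have F': "gabs_continuous g a b (\<lambda>x. - F x)"
  proof -
    have "norm (- F d - - F c) = norm (F d - F c)" for c d by (simp add: abs_minus_commute)
    then show ?thesis using F unfolding gabs_continuous_def by simp
  qed
  obtain P N where PN: "mono_on {a..b} P" "mono_on {a..b} N" "chain_ac g a b P" "chain_ac g a b N"
    "\<And>x. F x = P x - N x"
    using chain_ac_monotone_decomposition[OF g less_imp_le[OF \<open>a < b\<close>] gabs_continuous_imp_chain_ac[OF F]
        gabs_continuous_imp_chain_ac[OF F']] by blast
  obtain p where p: "integrable (stieltjes_on g a b) p" "\<And>x. x \<in> {a..b} \<Longrightarrow> P x = P a + (LINT t:{a..<x}|stieltjes_on g a b. p t)"
    using chain_ac_mono_integral[OF g \<open>a < b\<close> PN(1,3)] by blast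
  obtain n where n: "integrable (stieltjes_on g a b) n" "\<And>x. x \<in> {a..b} \<Longrightarrow> N x = N a + (LINT t:{a..<x}|stieltjes_on g a b. n t)"
    using chain_ac_mono_integral[OF g \<open>a < b\<close> PN(2,4)] by blast
  have si: "set_integrable (stieltjes_on g a b) {a..<x} p" "set_integrable (stieltjes_on g a b) {a..<x} n" for x
    unfolding set_integrable_def using p(1) n(1) by (auto intro!: integrable_mult_indicator simp del: real_scaleR_def)
  show ?thesis
  proof (intro exI[of _ "\<lambda>t. p t - n t"] conjI ballI)
    show "integrable (stieltjes_on g a b) (\<lambda>t. p t - n t)" using p n by auto
    fix x assume "x \<in> {a..b}"
    then show "F x = F a + (LINT t:{a..<x}|stieltjes_on g a b. p t - n t)"
      using p(2)[of x] n(2)[of x] si[of x] by (simp add: PN(5) set_integral_diff)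
  qed
qed

section \<open>Differentiation of integrals on the line\<close>

text \<open>A subfamily of least cardinality with the same union works. Among its intervals through
  \<open>x\<close>, one with the leftmost left end and one with the rightmost right end cover all
  the others, so minimality leaves no third.\<close>

lemma finite_cover_multiplicity_two:
  fixes \<I> :: "(real \<times> real) set"
  assumes "finite \<I>"
  obtains \<J> where "\<J> \<subseteq> \<I>" "(\<Union>(u, v)\<in>\<J>. {u..<v}) = (\<Union>(u, v)\<in>\<I>. {u..<v})"
    "\<And>x. card {I \<in> \<J>. x \<in> {fst I..<snd I}} \<le> 2"
proof -
  define Q where "Q \<J> \<longleftrightarrow> \<J> \<subseteq> \<I> \<and> (\<Union>(u, v)\<in>\<J>. {u..<v}) = (\<Union>(u, v)\<in>\<I>. {u..<v})" for \<J>
  have "Q \<I>" by (simp add: Q_def)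
  then obtain \<J> where \<J>: "Q \<J>" and min: "\<And>\<J>'. Q \<J>' \<Longrightarrow> card \<J> \<le> card \<J>'"
    using ex_has_least_nat[of Q \<I> card] by blast
  have fin: "finite \<J>"
    using \<J> assms finite_subset by (auto simp: Q_def)
  have "card {I \<in> \<J>. x \<in> {fst I..<snd I}} \<le> 2" for x
  proof (cases "{I \<in> \<J>. x \<in> {fst I..<snd I}} = {}")
    case True
    show ?thesis unfolding True by simp
  next
    case False
    define S where "S = {I \<in> \<J>. x \<in> {fst I..<snd I}}"
    have "finite S" "S \<noteq> {}" "S \<subseteq> \<J>"
      using fin False by (auto simp: S_def)
    obtain l where l: "l \<in> S" "\<And>I. I \<in> S \<Longrightarrow> fst l \<le> fst I"
      using arg_min_least[OF \<open>finite S\<close> \<open>S \<noteq> {}\<close>, where f = fst] arg_min_if_finite(1)[OF \<open>finite S\<close> \<open>S \<noteq> {}\<close>, where f = fst]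
      by blast
    obtain r where r: "r \<in> S" "\<And>I. I \<in> S \<Longrightarrow> - snd r \<le> - snd I"
      using arg_min_least[OF \<open>finite S\<close> \<open>S \<noteq> {}\<close>, where f = "\<lambda>I. - snd I"]
        arg_min_if_finite(1)[OF \<open>finite S\<close> \<open>S \<noteq> {}\<close>, where f = "\<lambda>I. - snd I"]
      by blast
    define \<J>' where "\<J>' = (\<J> - S) \<union> {l, r}"
    have "\<J>' \<subseteq> \<J>"
      using l(1) r(1) \<open>S \<subseteq> \<J>\<close> by (auto simp: \<J>'_def)
    have cov: "{fst I..<snd I} \<subseteq> {fst l..<snd l} \<union> {fst r..<snd r}" if "I \<in> S" for I
      using l(1) r(1) l(2)[OF that] r(2)[OF that] by (auto simp: S_def)
    have "(\<Union>(u, v)\<in>\<J>. {u..<v}) \<subseteq> (\<Union>(u, v)\<in>\<J>'. {u..<v})"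
    proof
      fix y assume "y \<in> (\<Union>(u, v)\<in>\<J>. {u..<v})"
      then obtain I where I: "I \<in> \<J>" "y \<in> {fst I..<snd I}" unfolding case_prod_beta by blast
      show "y \<in> (\<Union>(u, v)\<in>\<J>'. {u..<v})"
      proof (cases "I \<in> S")
        case True
        then have "y \<in> {fst l..<snd l} \<union> {fst r..<snd r}" using cov[of I] I(2) by blast
        then show ?thesis unfolding \<J>'_def case_prod_beta by blast
      next
        case False
        then have "I \<in> \<J>'" using I(1) by (simp add: \<J>'_def)
        then show ?thesis using I(2) unfolding case_prod_beta by blast
      qed
    qed
    moreover have "(\<Union>(u, v)\<in>\<J>'. {u..<v}) \<subseteq> (\<Union>(u, v)\<in>\<J>. {u..<v})"
      using \<open>\<J>' \<subseteq> \<J>\<close> by blast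
    ultimately have "(\<Union>(u, v)\<in>\<J>'. {u..<v}) = (\<Union>(u, v)\<in>\<J>. {u..<v})"
      by (intro subset_antisym)
    then have "Q \<J>'"
      using \<J> \<open>\<J>' \<subseteq> \<J>\<close> unfolding Q_def by (auto simp del: UN_simps)
    then have "card \<J> \<le> card \<J>'" by (rule min)
    then have "\<J>' = \<J>"
      using \<open>\<J>' \<subseteq> \<J>\<close> fin by (metis card_seteq)
    then have "S \<subseteq> {l, r}"
      using \<open>S \<subseteq> \<J>\<close> by (auto simp: \<J>'_def)
    then have "card S \<le> card {l, r}" by (intro card_mono) auto
    also have "\<dots> \<le> 2" by (simp add: card_insert_if)
    finally show ?thesis by (simp add: S_def)
  qed
  moreover have "\<J> \<subseteq> \<I>" "(\<Union>(u, v)\<in>\<J>. {u..<v}) = (\<Union>(u, v)\<in>\<I>. {u..<v})"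
    using \<J> by (simp_all add: Q_def)
  ultimately show ?thesis
    by (rule that[rotated 2])
qed

text \<open>The indicators of the thinned family sum to at most \<open>2 * indicator U\<close>;
  integrating this against \<open>N\<close> produces the factor 2.\<close>

lemma finite_cover_measure_le:
  fixes M N :: "real measure"
  assumes M: "finite_measure M" "sets M = sets borel" and N: "finite_measure N" "sets N = sets borel"
    and "c > 0" and fin: "finite \<I>" and "U \<in> sets borel"
    and \<I>: "\<And>u v. (u, v) \<in> \<I> \<Longrightarrow> {u..<v} \<subseteq> U \<and> c * measure M {u..<v} \<le> measure N {u..<v}"
  shows "c * measure M (\<Union>(u, v)\<in>\<I>. {u..<v}) \<le> 2 * measure N U"
proof -
  interpret M: finite_measure M by fact
  interpret N: finite_measure N by fact
  obtain \<J> where \<J>: "\<J> \<subseteq> \<I>" "(\<Union>(u, v)\<in>\<J>. {u..<v}) = (\<Union>(u, v)\<in>\<I>. {u..<v})"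
    "\<And>x. card {I \<in> \<J>. x \<in> {fst I..<snd I}} \<le> 2"
    using finite_cover_multiplicity_two[OF fin] by blast
  have fJ: "finite \<J>" using \<J>(1) fin finite_subset by blast
  have "c * measure M (\<Union>(u, v)\<in>\<I>. {u..<v}) = c * measure M (\<Union>I\<in>\<J>. {fst I..<snd I})"
    using \<J>(2) by (simp add: case_prod_beta)
  also have "\<dots> \<le> c * (\<Sum>I\<in>\<J>. measure M {fst I..<snd I})"
  proof (rule mult_left_mono)
    show "measure M (\<Union>I\<in>\<J>. {fst I..<snd I}) \<le> (\<Sum>I\<in>\<J>. measure M {fst I..<snd I})"
      by (rule M.finite_measure_subadditive_finite[OF fJ]) (simp add: M(2) image_subset_iff)
  qed (use \<open>c > 0\<close> in simp)
  also have "\<dots> = (\<Sum>I\<in>\<J>. c * measure M {fst I..<snd I})"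
    by (simp add: sum_distrib_left)
  also have "\<dots> \<le> (\<Sum>I\<in>\<J>. measure N {fst I..<snd I})"
  proof (rule sum_mono)
    fix I assume "I \<in> \<J>"
    then have "(fst I, snd I) \<in> \<I>" using \<J>(1) by auto
    then show "c * measure M {fst I..<snd I} \<le> measure N {fst I..<snd I}" using \<I> by blast
  qed
  also have "\<dots> = (\<Sum>I\<in>\<J>. \<integral>x. indicator {fst I..<snd I} x \<partial>N)"
    by (intro sum.cong refl) (simp add: N(2))
  also have "\<dots> = (\<integral>x. (\<Sum>I\<in>\<J>. indicator {fst I..<snd I} x) \<partial>N)"
    by (rule Bochner_Integration.integral_sum[symmetric]) (simp add: N(2) N.emeasure_eq_measure)
  also have "\<dots> \<le> (\<integral>x. 2 * indicator U x \<partial>N)"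
  proof (intro integral_mono)
    fix x
    have "(\<Sum>I\<in>\<J>. indicator {fst I..<snd I} x) = (real (card {I \<in> \<J>. x \<in> {fst I..<snd I}}))"
      using fJ by (simp only: indicator_def sum_of_bool_eq Int_def mem_Collect_eq)
    moreover have "{I \<in> \<J>. x \<in> {fst I..<snd I}} = {}" if "x \<notin> U"
    proof -
      have "{fst I..<snd I} \<subseteq> U" if "I \<in> \<J>" for I
        using \<I>[of "fst I" "snd I"] \<J>(1) that by auto
      with that show ?thesis by blast
    qed
    ultimately show "(\<Sum>I\<in>\<J>. indicator {fst I..<snd I} x) \<le> (2 * indicator U x :: real)"
      using \<J>(3)[of x] by (cases "x \<in> U") auto
  next
    show "integrable N (\<lambda>x. 2 * indicator U x :: real)"
      using \<open>U \<in> sets borel\<close> by (intro integrable_mult_right integrable_real_indicator) (simp_all add: N(2) N.emeasure_eq_measure)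
    show "integrable N (\<lambda>x. \<Sum>I\<in>\<J>. indicator {fst I..<snd I} x :: real)"
      by (intro Bochner_Integration.integrable_sum integrable_real_indicator) (simp_all add: N(2) N.emeasure_eq_measure)
  qed
  also have "\<dots> = 2 * measure N U"
    using N(2) \<open>U \<in> sets borel\<close> by simp
  finally show ?thesis .
qed

text \<open>A point of \<open>B\<close> may be the left end of its interval, so the open interiors
  need not cover \<open>B\<close>. Being strict, the inequality survives a small extension of the
  interval to the left, by continuity of both measures from above. Countably many of the resulting
  interiors suffice, and the finite estimate passes to the limit along increasing finite
  unions.\<close>

lemma cover_measure_le:
  fixes M N :: "real measure"
  assumes M: "finite_measure M" "sets M = sets borel" and N: "finite_measure N" "sets N = sets borel"
    and "c > 0" and "open U"
    and B: "\<And>t. t \<in> B \<Longrightarrow> \<exists>u v. u \<le> t \<and> t < v \<and> {u..<v} \<subseteq> U \<and> c * measure M {u..<v} < measure N {u..<v}"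
  obtains W where "open W" "B \<subseteq> W" "c * measure M W \<le> 2 * measure N U"
proof -
  interpret M: finite_measure M by fact
  interpret N: finite_measure N by fact
  define \<I> where "\<I> = {(u, v). {u..<v} \<subseteq> U \<and> c * measure M {u..<v} < measure N {u..<v}}"
  define W where "W = (\<Union>(u, v)\<in>\<I>. {u<..<v})"
  have "open W" by (auto simp: W_def)
  have "B \<subseteq> W"
  proof
    fix t assume "t \<in> B"
    then obtain u v where uv: "u \<le> t" "t < v" "{u..<v} \<subseteq> U" "c * measure M {u..<v} < measure N {u..<v}"
      using B by blast
    define A where "A n = {u - 1 / real (Suc n)..<v}" for n
    have dec: "decseq A"
    proof (rule decseq_SucI)
      fix n
      have "1 / real (Suc (Suc n)) \<le> 1 / real (Suc n)" by (simp add: field_simps)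
      then show "A (Suc n) \<subseteq> A n" by (auto simp: A_def)
    qed
    have int: "(\<Inter>n. A n) = {u..<v}"
    proof
      show "(\<Inter>n. A n) \<subseteq> {u..<v}"
      proof
        fix x assume x: "x \<in> (\<Inter>n. A n)"
        have "u \<le> x"
        proof (rule ccontr)
          assume "\<not> u \<le> x"
          then obtain n where "inverse (real (Suc n)) < u - x"
            using reals_Archimedean[of "u - x"] by auto
          moreover have "u - 1 / real (Suc n) \<le> x" using x by (auto simp: A_def)
          ultimately show False by (simp add: inverse_eq_divide)
        qed
        then show "x \<in> {u..<v}" using x by (auto simp: A_def)
      qed
      show "{u..<v} \<subseteq> (\<Inter>n. A n)"
      proof (intro INT_greatest subsetI)
        fix x n assume "x \<in> {u..<v}"
        moreover have "0 \<le> 1 / real (Suc n)" by simp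
        ultimately show "x \<in> A n" unfolding A_def atLeastLessThan_iff by linarith
      qed
    qed
    have "(\<lambda>n. measure N (A n) - c * measure M (A n)) \<longlonglongrightarrow> measure N {u..<v} - c * measure M {u..<v}"
      unfolding int[symmetric]
      by (intro tendsto_intros N.finite_Lim_measure_decseq M.finite_Lim_measure_decseq dec)
        (simp_all add: A_def M(2) N(2) image_subset_iff)
    then have "\<forall>\<^sub>F n in sequentially. 0 < measure N (A n) - c * measure M (A n)"
      using uv(4) by (intro order_tendstoD(1)) auto
    moreover have "\<forall>\<^sub>F n in sequentially. A n \<subseteq> U"
    proof -
      have "u \<in> U" using uv by auto
      then obtain e where e: "e > 0" "\<And>y. dist y u < e \<Longrightarrow> y \<in> U"
        using \<open>open U\<close> by (meson open_dist)
      have "(\<lambda>n. 1 / real (Suc n)) \<longlonglongrightarrow> 0"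
        using LIMSEQ_inverse_real_of_nat by (simp add: inverse_eq_divide)
      then have "\<forall>\<^sub>F n in sequentially. 1 / real (Suc n) < e"
        using e(1) by (rule order_tendstoD)
      then show ?thesis
      proof eventually_elim
        case (elim n)
        show ?case
        proof
          fix y assume y: "y \<in> A n"
          show "y \<in> U"
          proof (cases "y < u")
            case True
            then show ?thesis using y elim by (intro e(2)) (auto simp: A_def dist_real_def)
          next
            case False
            then show ?thesis using y uv(3) by (auto simp: A_def)
          qed
        qed
      qed
    qed
    ultimately have "\<forall>\<^sub>F n in sequentially. 0 < measure N (A n) - c * measure M (A n) \<and> A n \<subseteq> U"
      by eventually_elim simp
    then obtain n where n: "c * measure M (A n) < measure N (A n)" "A n \<subseteq> U"
      by (auto dest!: eventually_happens)
    then have "(u - 1 / real (Suc n), v) \<in> \<I>" by (auto simp: \<I>_def A_def)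
    moreover have "t \<in> {u - 1 / real (Suc n)<..<v}"
    proof -
      have "0 < 1 / real (Suc n)" by simp
      with uv show ?thesis unfolding greaterThanLessThan_iff by linarith
    qed
    ultimately show "t \<in> W" unfolding W_def by blast
  qed
  have "open S" if "S \<in> (\<lambda>(u, v). {u<..<v}) ` \<I>" for S
    using that by auto
  from Lindelof[OF this] obtain \<V> where "\<V> \<subseteq> (\<lambda>(u, v). {u<..<v}) ` \<I>" "countable \<V>"
    and \<V>: "\<Union>\<V> = W"
    unfolding W_def by metis
  then obtain \<I>' where \<I>': "countable \<I>'" "\<I>' \<subseteq> \<I>" "\<V> = (\<lambda>(u, v). {u<..<v}) ` \<I>'"
    by (metis countable_subset_image)
  have "c * measure M W \<le> 2 * measure N U"
  proof (cases "\<I>' = {}")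
    case True
    then show ?thesis using \<V> \<I>'(3) by simp
  next
    case False
    define S where "S n = (\<Union>(u, v)\<in>from_nat_into \<I>' ` {..<n}. {u..<v})" for n
    have S: "c * measure M (S n) \<le> 2 * measure N U" for n
      unfolding S_def
    proof (rule finite_cover_measure_le[OF M N \<open>c > 0\<close>])
      fix u v assume "(u, v) \<in> from_nat_into \<I>' ` {..<n}"
      then have "(u, v) \<in> \<I>" using from_nat_into[OF False] \<I>'(2) by auto
      then show "{u..<v} \<subseteq> U \<and> c * measure M {u..<v} \<le> measure N {u..<v}" by (auto simp: \<I>_def)
    qed (use \<open>open U\<close> in auto)
    have Sm: "S n \<in> sets M" for n unfolding S_def M(2) by (intro sets.finite_UN) auto
    have "(\<lambda>n. c * measure M (S n)) \<longlonglongrightarrow> c * measure M (\<Union>n. S n)"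
      using Sm by (intro tendsto_intros M.finite_Lim_measure_incseq incseq_SucI)
        (auto simp: S_def lessThan_Suc)
    then have "c * measure M (\<Union>n. S n) \<le> 2 * measure N U"
      using S by (intro LIMSEQ_le_const2) auto
    moreover have "measure M W \<le> measure M (\<Union>n. S n)"
    proof (intro M.finite_measure_mono)
      show "W \<subseteq> (\<Union>n. S n)"
      proof
        fix x assume "x \<in> W"
        then obtain I where I: "I \<in> \<I>'" "x \<in> {fst I<..<snd I}"
          unfolding \<V>[symmetric] \<I>'(3) by auto
        then obtain k where "from_nat_into \<I>' k = I"
          using from_nat_into_surj[OF \<I>'(1)] by blast
        then have "x \<in> S (Suc k)"
          using I(2) unfolding S_def by (auto simp: case_prod_beta intro!: bexI[of _ k])
        then show "x \<in> (\<Union>n. S n)" by blast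
      qed
    qed (use Sm in auto)
    ultimately show ?thesis
      using \<open>c > 0\<close> by (meson mult_left_mono order.trans less_imp_le)
  qed
  with \<open>open W\<close> \<open>B \<subseteq> W\<close> show ?thesis by (rule that)
qed

text \<open>On \<open>{h \<le> q}\<close> the measure \<open>(h - q)\<^sup>+ M\<close> vanishes, so by outer regularity it is small on
  an open neighbourhood, whereas it exceeds \<open>(r - q) M\<close> on the intervals with average above \<open>r\<close>.\<close>

lemma AE_interval_average_le:
  fixes M :: "real measure" and h :: "real \<Rightarrow> real"
  assumes M: "finite_measure M" "sets M = sets borel" and h: "integrable M h" and "q < r"
  shows "AE t in M. h t \<le> q \<longrightarrow> (\<exists>d>0. \<forall>u v. t - d < u \<and> u \<le> t \<and> t < v \<and> v < t + d \<longrightarrow>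
    (LINT x:{u..<v}|M. h x) \<le> r * measure M {u..<v})"
proof -
  interpret M: finite_measure M by fact
  have [measurable_cong]: "sets M = sets borel" by fact
  have [measurable]: "h \<in> borel_measurable M" using h by auto
  have sp: "space M = UNIV" using sets_eq_imp_space_eq[OF M(2)] by simp
  define p where "p x = max 0 (h x - q)" for x
  have ip: "integrable M p"
    unfolding p_def using h by (intro integrable_max) auto
  have [measurable]: "p \<in> borel_measurable M" using ip by auto
  define N where "N = density M (\<lambda>x. ennreal (p x))"
  have sN: "sets N = sets borel" by (simp add: N_def M(2))
  have N: "emeasure N A = ennreal (LINT x:A|M. p x)" if "A \<in> sets borel" for A
  proof -
    have "emeasure N A = (\<integral>\<^sup>+x. ennreal (indicator A x * p x) \<partial>M)"
      using that unfolding N_def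
      by (subst emeasure_density) (auto simp: M(2) indicator_def intro!: nn_integral_cong)
    also have "\<dots> = ennreal (LINT x:A|M. p x)"
      unfolding set_lebesgue_integral_def real_scaleR_def
    proof (rule nn_integral_eq_integral)
      show "integrable M (\<lambda>x. indicator A x * p x)"
        using that integrable_mult_indicator[OF _ ip, of A] by (simp add: M(2))
    qed (simp add: p_def)
    finally show ?thesis .
  qed
  have fN: "finite_measure N"
    by (rule finite_measureI) (use N[of UNIV] sN sets_eq_imp_space_eq[OF sN] in simp)
  interpret N: finite_measure N by fact
  have mN: "measure N {u..<v} \<ge> (LINT x:{u..<v}|M. h x) - q * measure M {u..<v}" for u v
  proof -
    have *: "set_integrable M {u..<v} h" "set_integrable M {u..<v} (\<lambda>x. q)"
      "set_integrable M {u..<v} p"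
      unfolding set_integrable_def using h ip by (intro integrable_mult_indicator; simp add: M(2))+
    have "(LINT x:{u..<v}|M. h x) - q * measure M {u..<v} = (LINT x:{u..<v}|M. h x - q)"
      using * by (simp add: set_lebesgue_integral_def set_integrable_def algebra_simps M(2))
    also have "\<dots> \<le> (LINT x:{u..<v}|M. p x)"
    proof (rule set_integral_mono)
      show "h x - q \<le> p x" for x by (simp add: p_def)
    qed (use * in auto)
    also have "\<dots> = measure N {u..<v}"
    proof -
      have "0 \<le> (LINT x:{u..<v}|M. p x)"
        by (auto simp: p_def set_lebesgue_integral_def intro!: Bochner_Integration.integral_nonneg)
      then show ?thesis using N[of "{u..<v}"] by (simp add: measure_def)
    qed
    finally show ?thesis .
  qed
  define A where "A = {x. h x \<le> q}"
  have A: "A \<in> sets borel"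
  proof -
    have "{x \<in> space M. h x \<le> q} \<in> sets M" by measurable
    then show ?thesis by (simp add: sp M(2) A_def)
  qed
  have "emeasure N A = 0"
  proof -
    have "(LINT x:A|M. p x) = 0"
      unfolding set_lebesgue_integral_def
      by (rule Bochner_Integration.integral_eq_zero_AE) (auto simp: A_def p_def indicator_def)
    then show ?thesis using N[OF A] by simp
  qed
  define good where "good t \<longleftrightarrow> (\<exists>d>0. \<forall>u v. t - d < u \<and> u \<le> t \<and> t < v \<and> v < t + d \<longrightarrow>
    (LINT x:{u..<v}|M. h x) \<le> r * measure M {u..<v})" for t
  \<comment> \<open>Measurability of \<open>B\<close> is not apparent, so \<open>B\<close> is
    enclosed in open sets \<open>W n\<close> whose measures tend to 0; their intersection is a
    measurable null set.\<close>
  define B where "B = {t \<in> A. \<not> good t}"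
  have W: "\<exists>W. open W \<and> B \<subseteq> W \<and> (r - q) * measure M W \<le> 2 * e" if "e > 0" for e
  proof -
    have "(INF U \<in> {U. A \<subseteq> U \<and> open U}. emeasure N U) < ennreal e"
      using \<open>emeasure N A = 0\<close> \<open>e > 0\<close> outer_regular[OF sN _ A] by (simp add: N.emeasure_finite)
    then obtain U where U: "A \<subseteq> U" "open U" "emeasure N U < ennreal e"
      by (auto simp: INF_less_iff)
    have Ue: "measure N U < e"
      using U(3) \<open>e > 0\<close> by (simp add: N.emeasure_eq_measure ennreal_less_iff)
    have cov: "\<exists>u v. u \<le> t \<and> t < v \<and> {u..<v} \<subseteq> U \<and> (r - q) * measure M {u..<v} < measure N {u..<v}"
      if "t \<in> B" for t
    proof -
      have "t \<in> U" "\<not> good t" using that U(1) by (auto simp: B_def)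
      then obtain d where d: "d > 0" "\<And>y. dist y t < d \<Longrightarrow> y \<in> U"
        using U(2) by (meson open_dist)
      from \<open>\<not> good t\<close> d(1) obtain u v where uv: "t - d < u" "u \<le> t" "t < v" "v < t + d"
        "r * measure M {u..<v} < (LINT x:{u..<v}|M. h x)"
        unfolding good_def by (meson not_le)
      have "{u..<v} \<subseteq> U" using uv by (auto intro!: d(2) simp: dist_real_def)
      moreover have "(r - q) * measure M {u..<v} < measure N {u..<v}"
        using uv(5) mN[of u v] by (simp add: algebra_simps)
      ultimately show ?thesis using uv by blast
    qed
    obtain W where "open W" "B \<subseteq> W" "(r - q) * measure M W \<le> 2 * measure N U"
      using cover_measure_le[OF M fN sN _ U(2) cov] \<open>q < r\<close> by (metis diff_gt_0_iff_gt)
    with Ue show ?thesis by (intro exI[of _ W]) auto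
  qed
  have "\<exists>W. open W \<and> B \<subseteq> W \<and> (r - q) * measure M W \<le> 2 * (1 / real (Suc n))" for n
    by (rule W) simp
  then have "\<exists>W. \<forall>n. open (W n) \<and> B \<subseteq> W n \<and> (r - q) * measure M (W n) \<le> 2 * (1 / real (Suc n))"
    by (intro choice allI)
  then obtain W where W': "\<forall>n. open (W n) \<and> B \<subseteq> W n \<and> (r - q) * measure M (W n) \<le> 2 * (1 / real (Suc n))"
    by (elim exE)
  then have W: "open (W n)" "B \<subseteq> W n" "(r - q) * measure M (W n) \<le> 2 * (1 / real (Suc n))" for n
    by blast+
  have "(\<Inter>n. W n) \<in> null_sets M"
  proof -
    have m: "(\<Inter>n. W n) \<in> sets M" using W(1) by (auto simp: M(2))
    have "(r - q) * measure M (\<Inter>n. W n) \<le> 0"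
    proof (rule LIMSEQ_le_const)
      show "(\<lambda>n. 2 * (1 / real (Suc n))) \<longlonglongrightarrow> 0"
        using tendsto_mult[OF tendsto_const[of 2] LIMSEQ_inverse_real_of_nat] by (simp add: inverse_eq_divide)
      have "(r - q) * measure M (\<Inter>n. W n) \<le> 2 * (1 / real (Suc n))" for n
      proof -
        have "measure M (\<Inter>n. W n) \<le> measure M (W n)"
          using W(1) by (intro M.finite_measure_mono) (auto simp: M(2))
        with W(3)[of n] \<open>q < r\<close> show ?thesis
          by (meson diff_ge_0_iff_ge less_imp_le mult_left_mono order.trans)
      qed
      then show "\<exists>N. \<forall>n\<ge>N. (r - q) * measure M (\<Inter>n. W n) \<le> 2 * (1 / real (Suc n))" by blast
    qed
    then have "measure M (\<Inter>n. W n) = 0"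
      using \<open>q < r\<close> by (simp add: mult_le_0_iff measure_le_0_iff)
    then show ?thesis using m by (simp add: null_sets_def M.emeasure_eq_measure)
  qed
  moreover have "{t \<in> space M. \<not> (h t \<le> q \<longrightarrow> good t)} \<subseteq> (\<Inter>n. W n)"
    using W(2) by (auto simp: B_def A_def)
  ultimately show ?thesis
    unfolding good_def by (rule AE_I')
qed

text \<open>The one-sided estimate is applied to \<open>h\<close> and \<open>- h\<close> for the
  countably many rational pairs \<open>q < r\<close>; for a given \<open>e\<close> a pair with
  \<open>h t < q < r < h t + e\<close> is used. The multiplied form of the estimate covers intervals
  of measure zero as well.\<close>

theorem AE_interval_average:
  fixes M :: "real measure" and h :: "real \<Rightarrow> real"
  assumes M: "finite_measure M" "sets M = sets borel" and h: "integrable M h"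
  shows "AE t in M. \<forall>e>0. \<exists>d>0. \<forall>u v. t - d < u \<and> u \<le> t \<and> t < v \<and> v < t + d \<longrightarrow>
    \<bar>(LINT x:{u..<v}|M. h x) - h t * measure M {u..<v}\<bar> \<le> e * measure M {u..<v}"
proof -
  let ?P = "\<lambda>h q r t. h t \<le> q \<longrightarrow> (\<exists>d>0. \<forall>u v. t - d < u \<and> u \<le> t \<and> t < v \<and> v < t + d \<longrightarrow>
    (LINT x:{u..<v}|M. h x) \<le> r * measure M {u..<v})"
  have *: "AE t in M. \<forall>x\<in>{x. fst x < snd x}. ?P h' (real_of_rat (fst x)) (real_of_rat (snd x)) t"
    if "integrable M h'" for h' :: "real \<Rightarrow> real"
    using that by (intro AE_ball_countable' AE_interval_average_le M) (auto simp: of_rat_less)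
  have **: "\<exists>d>0. \<forall>u v. t - d < u \<and> u \<le> t \<and> t < v \<and> v < t + d \<longrightarrow>
      (LINT x:{u..<v}|M. h' x) \<le> (h' t + e) * measure M {u..<v}"
    if P: "\<forall>x\<in>{x. fst x < snd x}. ?P h' (real_of_rat (fst x)) (real_of_rat (snd x)) t" and "e > 0"
    for h' :: "real \<Rightarrow> real" and t e
  proof -
    obtain r where r: "h' t < of_rat r" "of_rat r < h' t + e"
      using \<open>e > 0\<close> of_rat_dense[of "h' t" "h' t + e"] by auto
    obtain q where q: "h' t < of_rat q" "(of_rat q :: real) < of_rat r"
      using of_rat_dense[of "h' t" "of_rat r"] r by auto
    have "?P h' (of_rat q) (of_rat r) t"
      using P[rule_format, of "(q, r)"] q(2) by (simp add: of_rat_less)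
    with q(1) obtain d where d: "d > 0" "\<And>u v. t - d < u \<and> u \<le> t \<and> t < v \<and> v < t + d \<Longrightarrow>
      (LINT x:{u..<v}|M. h' x) \<le> of_rat r * measure M {u..<v}"
      by (auto simp: less_imp_le)
    have "of_rat r * measure M S \<le> (h' t + e) * measure M S" for S
      using r(2) by (intro mult_right_mono) auto
    with d show ?thesis by (meson order.trans)
  qed
  have "AE t in M. (\<forall>x\<in>{x. fst x < snd x}. ?P h (real_of_rat (fst x)) (real_of_rat (snd x)) t) \<and>
    (\<forall>x\<in>{x. fst x < snd x}. ?P (\<lambda>x. - h x) (real_of_rat (fst x)) (real_of_rat (snd x)) t)"
    using *[OF h] *[of "\<lambda>x. - h x"] h by auto
  then show ?thesis
  proof eventually_elim
    case (elim t)
    show ?case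
    proof (intro allI impI)
      fix e :: real assume "e > 0"
      obtain d1 where d1: "d1 > 0" "\<And>u v. t - d1 < u \<and> u \<le> t \<and> t < v \<and> v < t + d1 \<Longrightarrow>
        (LINT x:{u..<v}|M. h x) \<le> (h t + e) * measure M {u..<v}"
        using **[OF conjunct1[OF elim] \<open>e > 0\<close>] by blast
      obtain d2 where d2: "d2 > 0" "\<And>u v. t - d2 < u \<and> u \<le> t \<and> t < v \<and> v < t + d2 \<Longrightarrow>
        (LINT x:{u..<v}|M. - h x) \<le> (- h t + e) * measure M {u..<v}"
        using **[OF conjunct2[OF elim] \<open>e > 0\<close>] by blast
      have "\<bar>(LINT x:{u..<v}|M. h x) - h t * measure M {u..<v}\<bar> \<le> e * measure M {u..<v}"
        if uv: "t - min d1 d2 < u" "u \<le> t" "t < v" "v < t + min d1 d2" for u v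
      proof -
        have "(LINT x:{u..<v}|M. - h x) = - (LINT x:{u..<v}|M. h x)"
          by (simp add: set_lebesgue_integral_def)
        moreover have "t - d1 < u" "v < t + d1" "t - d2 < u" "v < t + d2"
          using uv by linarith+
        ultimately show ?thesis
          using d1(2)[of u v] d2(2)[of u v] uv(2,3) by (simp add: abs_le_iff algebra_simps)
      qed
      with d1(1) d2(1) show "\<exists>d>0. \<forall>u v. t - d < u \<and> u \<le> t \<and> t < v \<and> v < t + d \<longrightarrow>
          \<bar>(LINT x:{u..<v}|M. h x) - h t * measure M {u..<v}\<bar> \<le> e * measure M {u..<v}"
        by (intro exI[of _ "min d1 d2"]) auto
    qed
  qed
qed

section \<open>The derivative of an absolutely continuous function\<close>

lemma set_integrable_stieltjes_on:
  fixes h :: "real \<Rightarrow> real"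
  assumes "integrable (stieltjes_on g a b) h" "A \<in> sets borel"
  shows "set_integrable (stieltjes_on g a b) A h"
  unfolding set_integrable_def using assms by (intro integrable_mult_indicator) auto

text \<open>\<open>{t}\<close> is the intersection of intervals \<open>[t, s n)\<close> with
  \<open>s n\<close> decreasing to \<open>t\<close>, so its measure is the limit of
  \<open>g (s n) - g t\<close>. Because \<open>t < b\<close>, these intervals fit into
  \<open>[a,b)\<close>.\<close>

lemma jump_eq_measure:
  assumes g: "derivator g" and t: "a \<le> t" "t < b"
  shows "jump g t = measure (stieltjes_on g a b) {t}" and "(g \<longlongrightarrow> g t + jump g t) (at_right t)"
proof -
  interpret M: finite_measure "stieltjes_on g a b" by (rule finite_measure_stieltjes_on[OF g])
  obtain l where l: "(g \<longlongrightarrow> l) (at_right t)"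
    using mono_at_right_tendsto[of g t] g by (auto simp: derivator_def)
  define s where "s n = t + (b - t) / real (Suc n)" for n
  have s: "t < s n" "s n \<le> b" "s (Suc n) \<le> s n" for n
  proof -
    show "t < s n" using t by (simp add: s_def)
    have "(b - t) / real (Suc n) \<le> (b - t) / 1" using t by (intro divide_left_mono) auto
    then show "s n \<le> b" by (simp add: s_def)
    show "s (Suc n) \<le> s n" unfolding s_def using t by (intro add_left_mono divide_left_mono) auto
  qed
  have sl: "s \<longlonglongrightarrow> t"
  proof -
    have "(\<lambda>n. t + (b - t) * inverse (real (Suc n))) \<longlonglongrightarrow> t + (b - t) * 0"
      by (intro tendsto_intros LIMSEQ_inverse_real_of_nat)
    then show ?thesis by (simp add: s_def[abs_def] divide_inverse)
  qed
  have "(\<Inter>n. {t..<s n}) = {t}"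
  proof
    show "(\<Inter>n. {t..<s n}) \<subseteq> {t}"
    proof
      fix x assume x: "x \<in> (\<Inter>n. {t..<s n})"
      then have "x \<le> t" by (intro LIMSEQ_le_const[OF sl]) (auto intro: less_imp_le)
      with x show "x \<in> {t}" by auto
    qed
  qed (use s in auto)
  moreover have "{t..<s (Suc n)} \<subseteq> {t..<s n}" for n
    using s(3)[of n] by auto
  then have "(\<lambda>n. measure (stieltjes_on g a b) {t..<s n}) \<longlonglongrightarrow> measure (stieltjes_on g a b) (\<Inter>n. {t..<s n})"
    by (intro M.finite_Lim_measure_decseq decseq_SucI) auto
  moreover have "measure (stieltjes_on g a b) {t..<s n} = g (s n) - g t" for n
    using t s[of n] by (intro measure_stieltjes_on_Ico[OF g]) auto
  ultimately have 1: "(\<lambda>n. g (s n) - g t) \<longlonglongrightarrow> measure (stieltjes_on g a b) {t}"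
    by simp
  have "filterlim s (at_right t) sequentially"
    unfolding filterlim_at using sl s(1) by (auto intro!: always_eventually simp: less_imp_neq[symmetric])
  then have "(\<lambda>n. g (s n)) \<longlonglongrightarrow> l" by (rule filterlim_compose[OF l])
  then have "(\<lambda>n. g (s n) - g t) \<longlonglongrightarrow> l - g t" by (intro tendsto_intros)
  with 1 have "measure (stieltjes_on g a b) {t} = l - g t" by (rule LIMSEQ_unique)
  moreover have "jump g t = l - g t"
    unfolding jump_def using tendsto_Lim[OF _ l] by simp
  ultimately show "jump g t = measure (stieltjes_on g a b) {t}" "(g \<longlongrightarrow> g t + jump g t) (at_right t)"
    using l by simp_all
qed

text \<open>Each point of \<open>const_set g\<close> has an open neighbourhood of measure zero, and
  by Lindelof the union of all open null sets is null.\<close>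

lemma AE_notin_const_set:
  assumes g: "derivator g"
  shows "AE t in borel_stieltjes g. t \<notin> const_set g"
proof -
  define \<U> where "\<U> = {U. open U \<and> U \<in> null_sets (borel_stieltjes g)}"
  have "open U" if "U \<in> \<U>" for U using that by (simp add: \<U>_def)
  from Lindelof[OF this] obtain \<V> where \<V>: "\<V> \<subseteq> \<U>" "countable \<V>" "\<Union>\<V> = \<Union>\<U>" .
  have "(\<Union>U\<in>\<V>. U) \<in> null_sets (borel_stieltjes g)"
    by (rule null_sets_UN'[OF \<V>(2)]) (use \<V>(1) in \<open>simp add: \<U>_def subset_eq\<close>)
  then have "\<Union>\<V> \<in> null_sets (borel_stieltjes g)" by (simp only: image_ident)
  moreover have "const_set g \<subseteq> \<Union>\<U>"
  proof
    fix t assume "t \<in> const_set g"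
    then have "\<forall>\<^sub>F s in nhds t. g s = g t" by (simp add: const_set_def)
    then obtain e where e: "e > 0" "\<And>s. dist s t < e \<Longrightarrow> g s = g t"
      by (auto simp: eventually_nhds_metric)
    have "g (t - e / 2) = g t" "g (t + e / 2) = g t"
      by (rule e(2), use e(1) in \<open>simp add: dist_real_def\<close>)+
    then have "{t - e / 2..<t + e / 2} \<in> null_sets (borel_stieltjes g)"
      using emeasure_borel_stieltjes_Ico[OF g, of "t - e / 2" "t + e / 2"] e(1) by (simp add: null_sets_def)
    then have "{t - e / 2<..<t + e / 2} \<in> null_sets (borel_stieltjes g)"
      by (rule null_sets_subset) auto
    then have "{t - e / 2<..<t + e / 2} \<in> \<U>" by (simp add: \<U>_def)
    moreover have "t \<in> {t - e / 2<..<t + e / 2}" using e(1) by simp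
    ultimately show "t \<in> \<Union>\<U>" by blast
  qed
  ultimately show ?thesis
    using \<V>(3) by (auto intro!: AE_I')
qed

section \<open>From increments over intervals to the derivative at a point\<close>

lemma has_gderiv_unique:
  assumes "has_gderiv g a b f D t" "has_gderiv g a b f D' t"
  shows "D = D'"
  using assms unfolding has_gderiv_def Let_def
  by (auto split: if_splits intro: tendsto_unique)

lemma gderiv_eqI: "has_gderiv g a b f D t \<Longrightarrow> gderiv g a b f t = D"
  unfolding gderiv_def by (blast intro: the_equality has_gderiv_unique)

text \<open>At a jump, \<open>u = t\<close> gives the required right limit. Where \<open>g\<close>
  is continuous, the left quotient needs the interval \<open>[s,t)\<close>, which misses
  \<open>t\<close> and is reached by letting \<open>v\<close> decrease to \<open>t\<close>. The case
  \<open>t = a\<close> without a jump is excluded: \<open>g\<close> may be constant to the right of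
  \<open>a\<close>, and then no admissible \<open>s\<close> approaches \<open>a\<close>.\<close>

lemma has_gderiv_from_increments:
  fixes F :: "real \<Rightarrow> real"
  assumes g: "derivator g" and t: "a \<le> t" "t < b"
    and const: "t \<notin> const_set g" and a: "t = a \<Longrightarrow> t \<in> jump_set g"
    and inc: "\<And>e. e > 0 \<Longrightarrow> \<exists>d>0. \<forall>u v. a \<le> u \<and> v \<le> b \<and> t - d < u \<and> u \<le> t \<and> t < v \<and> v < t + d \<longrightarrow>
      \<bar>F v - F u - D * (g v - g u)\<bar> \<le> e * (g v - g u)"
  shows "has_gderiv g a b F D t"
proof -
  have mono: "g x \<le> g y" if "x \<le> y" for x y
    using g that by (auto simp: derivator_def mono_def)
  have quot: "dist (gquot g F t s) D < e"
    if "\<bar>F s - F t - D * (g s - g t)\<bar> \<le> (e / 2) * \<bar>g s - g t\<bar>" "g s \<noteq> g t" "e > 0" for s e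
  proof -
    have "gquot g F t s - D = (F s - F t - D * (g s - g t)) / (g s - g t)"
      using that(2) by (simp add: gquot_def field_simps)
    then have "\<bar>gquot g F t s - D\<bar> \<le> e / 2"
      using that by (simp add: abs_divide pos_divide_le_eq)
    then show ?thesis using that(3) by (simp add: dist_real_def)
  qed
  show ?thesis
  proof (cases "t \<in> jump_set g")
    case True
    let ?S = "{s \<in> {a..b}. t < s \<and> g s \<noteq> g t}"
    have "jump g t > 0" using True by (simp add: jump_set_def)
    have "g t + jump g t \<le> g s" if "t < s" for s
    proof (rule tendsto_upperbound[OF jump_eq_measure(2)[OF g t]])
      have "\<forall>\<^sub>F x in at_right t. x < s" using that by (intro eventually_at_rightI[of t s]) auto
      then show "\<forall>\<^sub>F x in at_right t. g x \<le> g s" by eventually_elim (simp add: mono)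
    qed simp
    then have S: "?S = {t<..b}" using t \<open>jump g t > 0\<close> by force
    have "t islimpt ?S"
      unfolding S using t(2) by (simp add: islimpt_greaterThanLessThan1 islimpt_subset[of t "{t<..<b}"] subset_eq)
    then have "at t within ?S \<noteq> bot" by (simp add: trivial_limit_within)
    moreover have "(gquot g F t \<longlongrightarrow> D) (at t within ?S)"
    proof (rule tendstoI)
      fix e :: real assume "e > 0"
      then obtain d where d: "d > 0" "\<And>u v. a \<le> u \<and> v \<le> b \<and> t - d < u \<and> u \<le> t \<and> t < v \<and> v < t + d \<Longrightarrow>
          \<bar>F v - F u - D * (g v - g u)\<bar> \<le> e / 2 * (g v - g u)"
        using inc[of "e / 2"] by auto
      have "dist (gquot g F t s) D < e" if "s \<in> ?S" "dist s t < d" for s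
        using d(2)[of t s] d(1) that t mono[of t s] \<open>e > 0\<close>
        by (intro quot) (auto simp: dist_real_def abs_real_def split: if_splits)
      with d(1) show "\<forall>\<^sub>F s in at t within ?S. dist (gquot g F t s) D < e"
        unfolding eventually_at by blast
    qed
    ultimately show ?thesis using True by (simp add: has_gderiv_def)
  next
    case False
    let ?S = "{s \<in> {a..b}. g s \<noteq> g t}"
    have ab: "a < t" using t(1) a False by (cases "t = a") auto
    have "jump g t = 0"
      using False jump_eq_measure(1)[OF g t] measure_nonneg[of "stieltjes_on g a b" "{t}"] by (simp add: jump_set_def)
    then have rc: "(g \<longlongrightarrow> g t) (at_right t)" using jump_eq_measure(2)[OF g t] by simp
    have "t islimpt ?S"
      unfolding islimpt_approachable
    proof (intro allI impI)
      fix e :: real assume "e > 0"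
      define e' where "e' = min e (min (t - a) (b - t))"
      have "e' > 0" using \<open>e > 0\<close> ab t(2) by (simp add: e'_def)
      moreover have "\<not> (\<forall>\<^sub>F s in nhds t. g s = g t)" using const by (simp add: const_set_def)
      ultimately obtain s where s: "dist s t < e'" "g s \<noteq> g t"
        unfolding eventually_nhds_metric by blast
      then have "s \<in> ?S" by (auto simp: e'_def dist_real_def abs_real_def split: if_splits)
      moreover have "s \<noteq> t" "dist s t < e" using s by (auto simp: e'_def)
      ultimately show "\<exists>x'\<in>?S. x' \<noteq> t \<and> dist x' t < e" by blast
    qed
    then have "at t within ?S \<noteq> bot" by (simp add: trivial_limit_within)
    moreover have "(gquot g F t \<longlongrightarrow> D) (at t within ?S)"
    proof (rule tendstoI)
      fix e :: real assume "e > 0"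
      then obtain d where d: "d > 0" "\<And>u v. a \<le> u \<and> v \<le> b \<and> t - d < u \<and> u \<le> t \<and> t < v \<and> v < t + d \<Longrightarrow>
          \<bar>F v - F u - D * (g v - g u)\<bar> \<le> e / 2 * (g v - g u)"
        using inc[of "e / 2"] by auto
      \<comment> \<open>The increment over \<open>[s,t)\<close> is the difference of those over
        \<open>[s,v)\<close> and \<open>[t,v)\<close>, both of the permitted kind. Only the bound
        still depends on \<open>v\<close>, and it converges because \<open>g\<close> is
        right-continuous at \<open>t\<close>.\<close>
      have left: "\<bar>F t - F s - D * (g t - g s)\<bar> \<le> e / 2 * (g t - g s)" if s: "a \<le> s" "s < t" "t - d < s" for s
      proof (rule tendsto_lowerbound)
        show "((\<lambda>v. e / 2 * (g v - g s) + e / 2 * (g v - g t)) \<longlongrightarrow> e / 2 * (g t - g s)) (at_right t)"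
          using rc by (auto intro!: tendsto_eq_intros)
        have "\<forall>\<^sub>F v in at_right t. v < min b (t + d) \<and> t < v"
          using t(2) d(1) by (intro eventually_at_rightI[of t "min b (t + d)"]) auto
        then show "\<forall>\<^sub>F v in at_right t. \<bar>F t - F s - D * (g t - g s)\<bar> \<le> e / 2 * (g v - g s) + e / 2 * (g v - g t)"
        proof eventually_elim
          case (elim v)
          have "\<bar>F v - F s - D * (g v - g s)\<bar> \<le> e / 2 * (g v - g s)"
            "\<bar>F v - F t - D * (g v - g t)\<bar> \<le> e / 2 * (g v - g t)"
            using d(2)[of s v] d(2)[of t v] elim s t d(1) by auto
          moreover have "F t - F s - D * (g t - g s) =
            (F v - F s - D * (g v - g s)) - (F v - F t - D * (g v - g t))"
            by (simp add: algebra_simps)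
          ultimately show ?case by linarith
        qed
      qed simp
      have "dist (gquot g F t s) D < e" if s: "s \<in> ?S" "dist s t < d" for s
      proof (rule quot)
        show "\<bar>F s - F t - D * (g s - g t)\<bar> \<le> (e / 2) * \<bar>g s - g t\<bar>"
        proof (cases "t < s")
          case True
          then show ?thesis
            using d(2)[of t s] d(1) s t mono[of t s] by (auto simp: dist_real_def)
        next
          case False
          then have "s < t" using s by (cases s t rule: linorder_cases) auto
          have eq: "F t - F s - D * (g t - g s) = - (F s - F t - D * (g s - g t))"
            by (simp add: algebra_simps)
          have "\<bar>F s - F t - D * (g s - g t)\<bar> = \<bar>F t - F s - D * (g t - g s)\<bar>"
            unfolding eq by simp
          moreover note \<open>s < t\<close>
          ultimately show ?thesis
            using left[of s] s mono[of s t] by (simp add: dist_real_def)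
        qed
      qed (use s \<open>e > 0\<close> in auto)
      with d(1) show "\<forall>\<^sub>F s in at t within ?S. dist (gquot g F t s) D < e"
        unfolding eventually_at by blast
    qed
    ultimately show ?thesis using False const by (simp add: has_gderiv_def)
  qed
qed

text \<open>Almost every \<open>t\<close> lies in \<open>[a,b)\<close>, outside
  \<open>const_set g\<close>, is not a left end point \<open>a\<close> without a jump, and is a
  point where the averages of the density \<open>h\<close> converge. At such \<open>t\<close> the
  increments of \<open>F\<close>, being integrals of \<open>h\<close>, determine the
  derivative.\<close>

theorem gabs_continuous_FTC:
  fixes F :: "real \<Rightarrow> real"
  assumes g: "derivator g" and "a < b" and F: "gabs_continuous g a b F"
  shows "\<exists>h. integrable (stieltjes_on g a b) h \<and> (\<forall>x\<in>{a..b}. F x = F a + (LINT t:{a..<x}|stieltjes_on g a b. h t)) \<and>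
    (AE t in stieltjes_on g a b. gderiv g a b F t = h t)"
proof -
  let ?M = "stieltjes_on g a b"
  interpret M: finite_measure ?M by (rule finite_measure_stieltjes_on[OF g])
  obtain h where h: "integrable ?M h" "\<And>x. x \<in> {a..b} \<Longrightarrow> F x = F a + (LINT t:{a..<x}|?M. h t)"
    using gabs_continuous_integral[OF assms] by blast
  have Fd: "F v - F u = (LINT t:{u..<v}|?M. h t)" if "a \<le> u" "u \<le> v" "v \<le> b" for u v
  proof -
    have "{a..<v} = {a..<u} \<union> {u..<v}" using that by auto
    then have "(LINT t:{a..<v}|?M. h t) = (LINT t:{a..<u}|?M. h t) + (LINT t:{u..<v}|?M. h t)"
      using h(1) by (simp add: set_integral_Un set_integrable_stieltjes_on ivl_disj_int_two)
    then show ?thesis using h(2)[of u] h(2)[of v] that by simp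
  qed
  have "AE t in ?M. t \<noteq> a \<or> a \<in> jump_set g"
  proof (cases "a \<in> jump_set g")
    case False
    then have "measure ?M {a} = 0"
      using jump_eq_measure(1)[OF g order_refl \<open>a < b\<close>] measure_nonneg[of ?M "{a}"] by (simp add: jump_set_def)
    then have "{a} \<in> null_sets ?M" by (simp add: null_sets_def M.emeasure_eq_measure)
    then show ?thesis by (intro AE_I'[of "{a}"]) auto
  qed simp
  moreover have "AE t in ?M. t \<notin> const_set g"
    using AE_notin_const_set[OF g] unfolding AE_stieltjes_on by eventually_elim simp
  moreover note AE_stieltjes_on_range[where g = g and a = a and b = b] AE_interval_average[OF M.finite_measure_axioms sets_stieltjes_on h(1)]
  ultimately have "AE t in ?M. gderiv g a b F t = h t"
  proof eventually_elim
    case (elim t)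
    show ?case
    proof (intro gderiv_eqI has_gderiv_from_increments[OF g])
      fix e :: real assume "e > 0"
      from elim(4)[THEN spec, THEN mp, OF this]
      obtain d where "d > 0" and d: "\<forall>u v. t - d < u \<and> u \<le> t \<and> t < v \<and> v < t + d \<longrightarrow>
          \<bar>(LINT x:{u..<v}|?M. h x) - h t * measure ?M {u..<v}\<bar> \<le> e * measure ?M {u..<v}"
        by (elim exE conjE)
      have "\<bar>F v - F u - h t * (g v - g u)\<bar> \<le> e * (g v - g u)"
        if "a \<le> u" "v \<le> b" "t - d < u" "u \<le> t" "t < v" "v < t + d" for u v
        using d[rule_format, of u v] Fd[of u v] measure_stieltjes_on_Ico[OF g, of a u v b] that by simp
      with \<open>d > 0\<close> show "\<exists>d>0. \<forall>u v. a \<le> u \<and> v \<le> b \<and> t - d < u \<and> u \<le> t \<and> t < v \<and> v < t + d \<longrightarrow>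
          \<bar>F v - F u - h t * (g v - g u)\<bar> \<le> e * (g v - g u)"
        by (intro exI[of _ d]) auto
    qed (use elim in auto)
  qed
  with h show ?thesis by blast
qed

section \<open>Iterated integrals\<close>

text \<open>For a measure carried by \<open>[a,b)\<close> this is the integral over
  \<open>[a,x)\<close>. Writing it over the whole line with a condition on \<open>t\<close> makes it
  a product integrand to which Fubini applies.\<close>

definition cumint :: "real measure \<Rightarrow> (real \<Rightarrow> real) \<Rightarrow> real \<Rightarrow> real" where
  "cumint M h x = (\<integral>t. (if t < x then h t else 0) \<partial>M)"

text \<open>The volume, under the \<open>n\<close>-fold product of \<open>M\<close>, of the simplex
  \<open>s < t1 < ... < tn < x\<close>. The index is one below the number of integrations: this is
  the kernel of the \<open>n + 1\<close>-fold cumulative integral.\<close>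

primrec iterated_kernel :: "real measure \<Rightarrow> nat \<Rightarrow> real \<Rightarrow> real \<Rightarrow> real" where
  "iterated_kernel M 0 s x = (if s < x then 1 else 0)"
| "iterated_kernel M (Suc n) s x = cumint M (iterated_kernel M n s) x"

lemma iterated_kernel_eq_0: "x \<le> s \<Longrightarrow> iterated_kernel M n s x = 0"
proof (induction n arbitrary: x)
  case (Suc n)
  then have "(if t < x then iterated_kernel M n s t else 0) = 0" for t by auto
  then show ?case by (simp add: cumint_def)
qed simp

locale finite_borel_measure = finite_measure M for M :: "real measure" +
  assumes sets_eq [simp, measurable_cong]: "sets M = sets borel"
begin

lemma space_eq [simp]: "space M = UNIV"
  using sets_eq_imp_space_eq[OF sets_eq] by simp

lemma measurable_iterated_kernel [measurable]: "case_prod (iterated_kernel M n) \<in> borel_measurable (borel \<Otimes>\<^sub>M borel)"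
proof (induction n)
  case 0
  have "case_prod (iterated_kernel M 0) = (\<lambda>p. if fst p < snd p then 1 else 0)" by (auto simp: fun_eq_iff)
  then show ?case by simp
next
  case (Suc n)
  note Suc [measurable]
  have "(\<lambda>(p, t). if t < snd p then iterated_kernel M n (fst p) t else 0) \<in> borel_measurable ((borel \<Otimes>\<^sub>M borel) \<Otimes>\<^sub>M M)"
    by measurable
  then have "(\<lambda>p. \<integral>t. (if t < snd p then iterated_kernel M n (fst p) t else 0) \<partial>M) \<in> borel_measurable (borel \<Otimes>\<^sub>M borel)"
    by (rule borel_measurable_lebesgue_integral)
  then show ?case by (simp add: cumint_def case_prod_beta')
qed

lemma measurable_iterated_kernel' [measurable]: "iterated_kernel M n s \<in> borel_measurable borel"
proof -
  have "(\<lambda>t. case_prod (iterated_kernel M n) (s, t)) \<in> borel_measurable borel" by measurable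
  then show ?thesis by simp
qed

lemma integrable_if_less:
  fixes h :: "real \<Rightarrow> real"
  assumes "integrable M h"
  shows "integrable M (\<lambda>t. if t < x then h t else 0)"
proof -
  have "(\<lambda>t. if t < x then h t else 0) = (\<lambda>t. indicator {..<x} t *\<^sub>R h t)"
    by (auto simp: fun_eq_iff indicator_def)
  then show ?thesis using assms by (simp only:) (intro integrable_mult_indicator; simp)
qed

lemma integrable_bounded:
  fixes h :: "real \<Rightarrow> real"
  assumes "h \<in> borel_measurable borel" "\<And>t. \<bar>h t\<bar> \<le> C"
  shows "integrable M h"
  using assms by (intro integrable_const_bound[of _ C]) auto

lemma measurable_cumint [measurable]:
  fixes h :: "real \<Rightarrow> real"
  assumes [measurable]: "h \<in> borel_measurable borel"
  shows "cumint M h \<in> borel_measurable borel"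
proof -
  have "(\<lambda>(x, t). if t < x then h t else 0) \<in> borel_measurable (borel \<Otimes>\<^sub>M M)" by measurable
  then show ?thesis unfolding cumint_def[abs_def] by (rule borel_measurable_lebesgue_integral)
qed

lemma integrable_cumint:
  assumes "integrable M h"
  shows "integrable M (cumint M h)"
proof (rule integrable_bounded)
  have "h \<in> borel_measurable M" using assms by auto
  then show "cumint M h \<in> borel_measurable borel" by (intro measurable_cumint) simp
  fix x
  have "\<bar>cumint M h x\<bar> \<le> (\<integral>t. \<bar>if t < x then h t else 0\<bar> \<partial>M)"
    unfolding cumint_def by (rule integral_abs_bound)
  also have "\<dots> \<le> (\<integral>t. \<bar>h t\<bar> \<partial>M)"
    using assms integrable_if_less[OF assms] by (intro integral_mono) auto
  finally show "\<bar>cumint M h x\<bar> \<le> (\<integral>t. \<bar>h t\<bar> \<partial>M)" .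
qed

lemma integrable_cumint_pow: "integrable M h \<Longrightarrow> integrable M ((cumint M ^^ n) h)"
  by (induction n) (auto intro: integrable_cumint)

lemma iterated_kernel_bounds: "0 \<le> iterated_kernel M n s x" "iterated_kernel M n s x \<le> measure M UNIV ^ n"
proof (induction n arbitrary: x)
  case (Suc n)
  {
    case 1
    show ?case using Suc by (auto simp: cumint_def intro!: Bochner_Integration.integral_nonneg)
  next
    case 2
    have "cumint M (iterated_kernel M n s) x \<le> (\<integral>t. measure M UNIV ^ n \<partial>M)"
      unfolding cumint_def using Suc
      by (intro integral_mono integrable_if_less integrable_bounded[of _ "measure M UNIV ^ n"]) auto
    then show ?case by (simp add: mult.commute)
  }
qed auto

lemma cumint_sum:
  assumes "\<And>k. k \<in> K \<Longrightarrow> integrable M (h k)"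
  shows "cumint M (\<lambda>t. \<Sum>k\<in>K. c k * h k t) x = (\<Sum>k\<in>K. c k * cumint M (h k) x)"
proof -
  have "(if t < x then \<Sum>k\<in>K. c k * h k t else 0) = (\<Sum>k\<in>K. c k * (if t < x then h k t else 0))" for t
    by simp
  then show ?thesis
    unfolding cumint_def using assms by (simp add: integrable_if_less)
qed

lemma cumint_add:
  assumes "integrable M h" "integrable M k"
  shows "cumint M (\<lambda>t. h t + k t) x = cumint M h x + cumint M k x"
proof -
  have "(if t < x then h t + k t else 0) = (if t < x then h t else 0) + (if t < x then k t else 0)" for t
    by simp
  then show ?thesis
    unfolding cumint_def using assms by (simp add: integrable_if_less)
qed

text \<open>Without atoms the kernel is Cauchy's \<open>(M [s,x))\<^sup>n / n!\<close>; in general the open condition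
  \<open>s < t < x\<close> matters, and produces the powers of the jump in \<open>gkernel\<close>.\<close>

lemma cumint_pow_eq_integral_iterated_kernel:
  assumes h: "integrable M h"
  shows "(cumint M ^^ Suc n) h x = (\<integral>s. h s * iterated_kernel M n s x \<partial>M)"
proof (induction n arbitrary: x)
  case 0
  have "(if t < x then h t else 0) = h t * iterated_kernel M 0 t x" for t by simp
  then show ?case by (simp add: cumint_def)
next
  case (Suc n)
  interpret P: pair_sigma_finite M M ..
  have [measurable]: "h \<in> borel_measurable M" using h by auto
  let ?k = "\<lambda>s t. if t < x then iterated_kernel M n s t else 0"
  let ?C = "measure M UNIV ^ n"
  have kb: "\<bar>?k s t\<bar> \<le> ?C" for s t
    using iterated_kernel_bounds[of n s t] by (auto simp: abs_real_def)
  have [measurable]: "case_prod ?k \<in> borel_measurable (borel \<Otimes>\<^sub>M borel)" by measurable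
  \<comment> \<open>The kernel is bounded by \<open>?C\<close>, and \<open>h s * ?C\<close> is
    integrable over the product because \<open>M\<close> is finite; it serves as the majorant for
    Fubini.\<close>
  have "integrable (M \<Otimes>\<^sub>M M) (\<lambda>(s, t). h s * ?C)"
  proof (rule P.Fubini_integrable)
    show "integrable M (\<lambda>s. \<integral>t. norm (case (s, t) of (s, t) \<Rightarrow> h s * ?C) \<partial>M)"
      using h by (simp add: abs_mult)
  qed auto
  then have int: "integrable (M \<Otimes>\<^sub>M M) (\<lambda>(s, t). h s * ?k s t)"
  proof (rule Bochner_Integration.integrable_bound)
    show "AE p in M \<Otimes>\<^sub>M M. norm (case p of (s, t) \<Rightarrow> h s * ?k s t) \<le> norm (case p of (s, t) \<Rightarrow> h s * ?C)"
    proof (intro AE_I2, clarify)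
      fix s t
      have "norm (h s * ?k s t) = \<bar>h s\<bar> * \<bar>?k s t\<bar>" by (simp add: abs_mult)
      also have "\<dots> \<le> \<bar>h s\<bar> * ?C" by (intro mult_left_mono kb) simp
      also have "\<dots> = norm (h s * ?C)" by (simp add: abs_mult)
      finally show "norm (h s * ?k s t) \<le> norm (h s * ?C)" .
    qed
  qed measurable
  have "(cumint M ^^ Suc (Suc n)) h x = (\<integral>t. (if t < x then (\<integral>s. h s * iterated_kernel M n s t \<partial>M) else 0) \<partial>M)"
  proof -
    have "(cumint M ^^ Suc n) h = (\<lambda>x. \<integral>s. h s * iterated_kernel M n s x \<partial>M)" by (rule ext) (rule Suc)
    then show ?thesis by (simp only: funpow.simps(2)[of "Suc n"] o_apply cumint_def)
  qed
  also have "\<dots> = (\<integral>t. (\<integral>s. h s * ?k s t \<partial>M) \<partial>M)"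
    by (intro Bochner_Integration.integral_cong) auto
  also have "\<dots> = (\<integral>s. (\<integral>t. h s * ?k s t \<partial>M) \<partial>M)"
    using int by (rule P.Fubini_integral)
  also have "\<dots> = (\<integral>s. h s * iterated_kernel M (Suc n) s x \<partial>M)"
    by (simp add: cumint_def)
  finally show ?case .
qed

lemma cumint_mono:
  assumes "integrable M h" "\<And>t. 0 \<le> h t"
  shows "mono (cumint M h)"
  unfolding cumint_def using assms by (intro monoI integral_mono integrable_if_less) auto

text \<open>The cumulative integrals of the positive and the negative part of \<open>h\<close> are
  monotone. This is the source of every proof of regulatedness below, apart from scaling.\<close>

lemma cumint_one_sided_limits:
  assumes h: "integrable M h"
  shows "\<exists>l. (cumint M h \<longlongrightarrow> l) (at_right t)" "\<exists>l. (cumint M h \<longlongrightarrow> l) (at_left t)"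
proof -
  let ?p = "\<lambda>t. max 0 (h t)" and ?n = "\<lambda>t. max 0 (- h t)"
  have i: "integrable M ?p" "integrable M ?n" using h by auto
  have "cumint M h x = cumint M ?p x + (-1) * cumint M ?n x" for x
  proof -
    have "cumint M ?p x = cumint M (\<lambda>t. h t + ?n t) x"
      by (intro arg_cong[where f = "\<lambda>h. cumint M h x"] ext) auto
    then show ?thesis using cumint_add[OF h i(2)] by simp
  qed
  then have eq: "cumint M h = (\<lambda>x. cumint M ?p x + (-1) * cumint M ?n x)" by blast
  have m: "mono (cumint M ?p)" "mono (cumint M ?n)" using i by (auto intro: cumint_mono)
  show "\<exists>l. (cumint M h \<longlongrightarrow> l) (at_right t)"
  proof -
    obtain l1 l2 where "(cumint M ?p \<longlongrightarrow> l1) (at_right t)" "(cumint M ?n \<longlongrightarrow> l2) (at_right t)"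
      using mono_at_right_tendsto[OF m(1)] mono_at_right_tendsto[OF m(2)] by metis
    then have "(cumint M h \<longlongrightarrow> l1 + (-1) * l2) (at_right t)"
      unfolding eq by (intro tendsto_intros)
    then show ?thesis ..
  qed
  show "\<exists>l. (cumint M h \<longlongrightarrow> l) (at_left t)"
  proof -
    obtain l1 l2 where "(cumint M ?p \<longlongrightarrow> l1) (at_left t)" "(cumint M ?n \<longlongrightarrow> l2) (at_left t)"
      using mono_at_left_tendsto[OF m(1)] mono_at_left_tendsto[OF m(2)] by metis
    then have "(cumint M h \<longlongrightarrow> l1 + (-1) * l2) (at_left t)"
      unfolding eq by (intro tendsto_intros)
    then show ?thesis ..
  qed
qed

end

section \<open>The monomials as cumulative integrals\<close>

lemma finite_borel_measure_stieltjes_on: "derivator g \<Longrightarrow> finite_borel_measure (stieltjes_on g a b)"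
  by (simp add: finite_borel_measure_def finite_borel_measure_axioms_def finite_measure_stieltjes_on)

lemma sigma_finite_borel_stieltjes:
  assumes "derivator g"
  shows "sigma_finite_measure (borel_stieltjes g)"
proof
  let ?A = "range (\<lambda>n. {- real n..<real n})"
  have "\<exists>n. x \<in> {- real n..<real n}" for x :: real
  proof -
    obtain n where "\<bar>x\<bar> < real n" using reals_Archimedean2 by blast
    then show ?thesis by (intro exI[of _ n]) auto
  qed
  then have "\<Union>?A = space (borel_stieltjes g)" by (auto simp: borel_stieltjes_def)
  moreover have "emeasure (borel_stieltjes g) {- real n..<real n} \<noteq> \<infinity>" for n
    using emeasure_borel_stieltjes_Ico[OF assms, of "- real n" "real n"] by simp
  ultimately show "\<exists>A. countable A \<and> A \<subseteq> sets (borel_stieltjes g) \<and> \<Union>A = space (borel_stieltjes g) \<and>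
      (\<forall>a\<in>A. emeasure (borel_stieltjes g) a \<noteq> \<infinity>)"
    by (intro exI[of _ ?A]) auto
qed

lemma set_integral_stieltjes_borel:
  fixes f :: "real \<Rightarrow> 'a::{banach, second_countable_topology}"
  assumes [measurable]: "f \<in> borel_measurable borel" "A \<in> sets borel"
  shows "set_integrable (stieltjes g) A f = set_integrable (borel_stieltjes g) A f"
    and "(LINT s:A|stieltjes g. f s) = (LINT s:A|borel_stieltjes g. f s)"
  unfolding set_integrable_def set_lebesgue_integral_def stieltjes_eq
  by (intro integrable_completion integral_completion; measurable)+

lemma set_integral_stieltjes_on:
  fixes f :: "real \<Rightarrow> 'a::{banach, second_countable_topology}"
  assumes [measurable]: "f \<in> borel_measurable borel" "A \<in> sets borel" and A: "A \<subseteq> {a..<b}"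
  shows "set_integrable (stieltjes_on g a b) A f = set_integrable (borel_stieltjes g) A f"
    and "(LINT s:A|stieltjes_on g a b. f s) = (LINT s:A|borel_stieltjes g. f s)"
proof -
  have l: "stieltjes_on g a b = density (borel_stieltjes g) (\<lambda>x. ennreal (indicator {a..<b} x))"
    by (simp add: stieltjes_on_def ennreal_indicator)
  have *: "indicator {a..<b} x *\<^sub>R indicator A x *\<^sub>R f x = indicator A x *\<^sub>R f x" for x
    using A by (auto simp: indicator_def)
  show "set_integrable (stieltjes_on g a b) A f = set_integrable (borel_stieltjes g) A f"
    unfolding set_integrable_def l by (subst integrable_density) (simp_all add: * del: scaleR_scaleR)
  show "(LINT s:A|stieltjes_on g a b. f s) = (LINT s:A|borel_stieltjes g. f s)"
    unfolding set_lebesgue_integral_def l by (subst integral_density) (simp_all add: * del: scaleR_scaleR)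
qed

lemma cumint_stieltjes_on_eq: "cumint (stieltjes_on g a b) h x = (LINT t:{a..<x}|stieltjes_on g a b. h t)" if [measurable]: "h \<in> borel_measurable borel"
  unfolding cumint_def set_lebesgue_integral_def
  by (intro Bochner_Integration.integral_cong_AE) (measurable, use AE_stieltjes_on_range[where g = g and a = a and b = b] in eventually_elim, auto)

text \<open>On a window \<open>[A,B]\<close> containing both end points the sign convention of
  \<open>gint\<close> disappears: in either order it is a difference of two values of one cumulative
  integral.\<close>

lemma gint_stieltjes_on:
  assumes g: "derivator g" and [measurable]: "f \<in> borel_measurable borel" and f: "integrable (stieltjes_on g A B) f"
    and xy: "x \<in> {A..B}" "y \<in> {A..B}"
  shows "gint g x y f = cumint (stieltjes_on g A B) f y - cumint (stieltjes_on g A B) f x"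
proof -
  let ?M = "stieltjes_on g A B"
  have si: "set_integrable ?M S f" if "S \<in> sets borel" for S
    unfolding set_integrable_def using f that by (intro integrable_mult_indicator) auto
  have *: "(LINT s:{u..<v}|stieltjes g. f s) = cumint ?M f v - cumint ?M f u" if "A \<le> u" "u \<le> v" "v \<le> B" for u v
  proof -
    have "{A..<v} = {A..<u} \<union> {u..<v}" using that by auto
    then have "(LINT t:{A..<v}|?M. f t) = (LINT t:{A..<u}|?M. f t) + (LINT t:{u..<v}|?M. f t)"
      by (simp add: set_integral_Un si ivl_disj_int_two)
    moreover have "(LINT s:{u..<v}|stieltjes g. f s) = (LINT t:{u..<v}|?M. f t)"
      using that by (subst set_integral_stieltjes_borel(2)) (auto intro!: set_integral_stieltjes_on(2)[symmetric])
    ultimately show ?thesis by (simp add: cumint_stieltjes_on_eq)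
  qed
  show ?thesis using xy by (auto simp: gint_def *)
qed

lemma measurable_gint:
  assumes g: "derivator g" and [measurable]: "f \<in> borel_measurable borel"
  shows "(\<lambda>x. gint g x0 x f) \<in> borel_measurable borel"
proof -
  interpret sigma_finite_measure "borel_stieltjes g" by (rule sigma_finite_borel_stieltjes[OF g])
  have "(\<lambda>(x, s). indicator {x0..<x} s *\<^sub>R f s) \<in> borel_measurable (borel \<Otimes>\<^sub>M borel_stieltjes g)"
    unfolding indicator_def atLeastLessThan_iff by measurable
  then have [measurable]: "(\<lambda>x. LINT s:{x0..<x}|borel_stieltjes g. f s) \<in> borel_measurable borel"
    unfolding set_lebesgue_integral_def by (rule borel_measurable_lebesgue_integral)
  have "(\<lambda>(x, s). indicator {x..<x0} s *\<^sub>R f s) \<in> borel_measurable (borel \<Otimes>\<^sub>M borel_stieltjes g)"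
    unfolding indicator_def atLeastLessThan_iff by measurable
  then have [measurable]: "(\<lambda>x. LINT s:{x..<x0}|borel_stieltjes g. f s) \<in> borel_measurable borel"
    unfolding set_lebesgue_integral_def by (rule borel_measurable_lebesgue_integral)
  show ?thesis
  proof -
    have eq: "(LINT s:{u..<v}|stieltjes g. f s) = (LINT s:{u..<v}|borel_stieltjes g. f s)" for u v
      by (rule set_integral_stieltjes_borel(2)) simp_all
    show ?thesis unfolding gint_def eq by measurable
  qed
qed

lemma measurable_gmonom: "derivator g \<Longrightarrow> gmonom g x0 k \<in> borel_measurable borel"
  by (induction k) (auto intro!: measurable_gint borel_measurable_times)

text \<open>The monomials are bounded by induction on a window enlarged to contain
  \<open>x0\<close>, because the integral from \<open>x0\<close> to \<open>x\<close> sees all values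
  between the two points.\<close>

lemma integrable_gmonom:
  assumes g: "derivator g"
  shows "integrable (stieltjes_on g A B) (gmonom g x0 k)"
proof -
  define A' B' where "A' = min A x0" and "B' = max B x0"
  interpret M: finite_borel_measure "stieltjes_on g A B" by (rule finite_borel_measure_stieltjes_on[OF g])
  interpret M': finite_borel_measure "stieltjes_on g A' B'" by (rule finite_borel_measure_stieltjes_on[OF g])
  have "\<exists>C. \<forall>x\<in>{A'..B'}. \<bar>gmonom g x0 k x\<bar> \<le> C"
  proof (induction k)
    case 0
    show ?case by (intro exI[of _ 1]) auto
  next
    case (Suc k)
    let ?h = "gmonom g x0 k"
    obtain C where C: "\<And>x. x \<in> {A'..B'} \<Longrightarrow> \<bar>?h x\<bar> \<le> C" using Suc by blast
    have i: "integrable (stieltjes_on g A' B') ?h"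
      using measurable_gmonom[OF g] C
      by (intro M'.integrable_const_bound[of _ C] eventually_mono[OF AE_stieltjes_on_range[where g = g and a = A' and b = B']]) auto
    have bound: "\<bar>cumint (stieltjes_on g A' B') ?h x\<bar> \<le> (\<integral>t. \<bar>?h t\<bar> \<partial>stieltjes_on g A' B')" for x
    proof -
      have "\<bar>cumint (stieltjes_on g A' B') ?h x\<bar> \<le> (\<integral>t. \<bar>if t < x then ?h t else 0\<bar> \<partial>stieltjes_on g A' B')"
        unfolding cumint_def by (rule integral_abs_bound)
      also have "\<dots> \<le> (\<integral>t. \<bar>?h t\<bar> \<partial>stieltjes_on g A' B')"
        using i M'.integrable_if_less[OF i] by (intro integral_mono) auto
      finally show ?thesis .
    qed
    have "\<bar>gint g x0 x ?h\<bar> \<le> 2 * (\<integral>t. \<bar>?h t\<bar> \<partial>stieltjes_on g A' B')" if "x \<in> {A'..B'}" for x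
    proof -
      have "x0 \<in> {A'..B'}" using that by (auto simp: A'_def B'_def)
      then have "\<bar>gint g x0 x ?h\<bar> \<le> \<bar>cumint (stieltjes_on g A' B') ?h x\<bar> + \<bar>cumint (stieltjes_on g A' B') ?h x0\<bar>"
        using gint_stieltjes_on[OF g measurable_gmonom[OF g] i _ that] by simp
      with bound[of x] bound[of x0] show ?thesis by simp
    qed
    then show ?case
      by (intro exI[of _ "real (Suc k) * (2 * (\<integral>t. \<bar>?h t\<bar> \<partial>stieltjes_on g A' B'))"])
        (simp add: abs_mult mult_left_mono del: of_nat_Suc)
  qed
  then obtain C where "\<And>x. x \<in> {A'..B'} \<Longrightarrow> \<bar>gmonom g x0 k x\<bar> \<le> C" by blast
  then have C: "\<bar>gmonom g x0 k x\<bar> \<le> C" if "x \<in> {A..<B}" for x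
    using that by (simp add: A'_def B'_def min_le_iff_disj le_max_iff_disj)
  show ?thesis
    using measurable_gmonom[OF g] C
    by (intro M.integrable_const_bound[of _ C] eventually_mono[OF AE_stieltjes_on_range[where g = g and a = A and b = B]]) auto
qed

lemma gmonom_Suc_stieltjes_on:
  assumes g: "derivator g" and "x0 \<in> {A..B}" "x \<in> {A..B}"
  shows "gmonom g x0 (Suc k) x =
    real (Suc k) * (cumint (stieltjes_on g A B) (gmonom g x0 k) x - cumint (stieltjes_on g A B) (gmonom g x0 k) x0)"
  using gint_stieltjes_on[OF g measurable_gmonom[OF g] integrable_gmonom[OF g] assms(2,3)] by simp

section \<open>Taylor formula and the kernel\<close>

lemma gmonom_Suc_self: "gmonom g x0 (Suc k) x0 = 0"
  by (simp add: gint_def set_lebesgue_integral_def)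

text \<open>The monomials integrate over \<open>[s,x)\<close> but the iterated kernel over \<open>(s,x)\<close>: the atom at \<open>s\<close>
  contributes the term \<open>k = 0\<close>.\<close>

lemma iterated_kernel_stieltjes_on_eq_sum:
  assumes g: "derivator g" and "a \<le> s"
  shows "s < x \<Longrightarrow> x \<le> b \<Longrightarrow>
    iterated_kernel (stieltjes_on g a b) n s x = (\<Sum>k\<le>n. (- jump g s) ^ (n - k) / fact k * gmonom g s k x)"
proof (induction n arbitrary: x)
  case 0
  then show ?case by simp
next
  case (Suc n)
  let ?M = "stieltjes_on g a b"
  interpret M: finite_borel_measure ?M by (rule finite_borel_measure_stieltjes_on[OF g])
  define c where "c k = (- jump g s) ^ (n - k) / fact k" for k
  define S where "S t = (\<Sum>k\<le>n. c k * gmonom g s k t)" for t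
  have iG: "integrable ?M (gmonom g s k)" for k by (rule integrable_gmonom[OF g])
  have iS: "integrable ?M S" unfolding S_def[abs_def] using iG by auto
  have ind: "integrable ?M (\<lambda>t. S s * indicator {s} t)"
    by (intro integrable_mult_right integrable_real_indicator) (auto simp: M.emeasure_eq_measure)
  \<comment> \<open>The integrand lives on \<open>(s,x)\<close>, where it equals \<open>S\<close> by
    induction. The integral over \<open>(s,x)\<close> is the one over \<open>t < x\<close>, less
    those over \<open>t < s\<close> and over the atom \<open>{s}\<close>.\<close>
  have "cumint ?M (iterated_kernel ?M n s) x =
      (\<integral>t. (if t < x then S t else 0) - (if t < s then S t else 0) - S s * indicator {s} t \<partial>?M)"
    unfolding cumint_def
  proof (rule Bochner_Integration.integral_cong_AE)
    show "(\<lambda>t. if t < x then iterated_kernel ?M n s t else 0) \<in> borel_measurable ?M" by measurable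
    show "(\<lambda>t. (if t < x then S t else 0) - (if t < s then S t else 0) - S s * indicator {s} t) \<in> borel_measurable ?M"
      using M.integrable_if_less[OF iS] ind by (intro borel_measurable_integrable Bochner_Integration.integrable_diff) auto
    show "AE t in ?M. (if t < x then iterated_kernel ?M n s t else 0) =
        (if t < x then S t else 0) - (if t < s then S t else 0) - S s * indicator {s} t"
      using AE_stieltjes_on_range[where g = g and a = a and b = b]
    proof eventually_elim
      case (elim t)
      have "iterated_kernel ?M n s t = S t" if "s < t" using that elim Suc.IH[of t] by (simp add: S_def c_def)
      then show ?case using Suc.prems iterated_kernel_eq_0[of t s ?M n]
        by (cases s t rule: linorder_cases) auto
    qed
  qed
  also have "\<dots> = cumint ?M S x - cumint ?M S s - S s * measure ?M {s}"
    unfolding cumint_def using M.integrable_if_less[OF iS] ind by simp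
  also have "\<dots> = cumint ?M S x - cumint ?M S s - S s * jump g s"
    using jump_eq_measure(1)[OF g \<open>a \<le> s\<close>, of b] Suc.prems by simp
  \<comment> \<open>At the base point only the monomial of degree 0 survives. Multiplied by
    \<open>- jump g s\<close>, this value becomes the degree 0 term of the next sum.\<close>
  also have "S s = (- jump g s) ^ n"
    unfolding S_def by (cases n) (simp_all add: sum.atMost_Suc_shift gmonom_Suc_self c_def del: gmonom.simps(2) sum.atMost_Suc)
  also have "cumint ?M S x - cumint ?M S s = (\<Sum>k\<le>n. c k * (cumint ?M (gmonom g s k) x - cumint ?M (gmonom g s k) s))"
    unfolding S_def[abs_def] using iG by (simp add: M.cumint_sum sum_subtractf right_diff_distrib)
  also have "\<dots> = (\<Sum>k\<le>n. (- jump g s) ^ (n - k) / fact (Suc k) * gmonom g s (Suc k) x)"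
  proof (rule sum.cong[OF refl])
    fix k
    have "s \<in> {a..b}" "x \<in> {a..b}" using Suc.prems \<open>a \<le> s\<close> by auto
    from gmonom_Suc_stieltjes_on[OF g this, of k]
    show "c k * (cumint ?M (gmonom g s k) x - cumint ?M (gmonom g s k) s) =
        (- jump g s) ^ (n - k) / fact (Suc k) * gmonom g s (Suc k) x"
      by (simp add: c_def del: of_nat_Suc gmonom.simps(2))
  qed
  finally show ?case
    by (simp add: sum.atMost_Suc_shift del: gmonom.simps(2) sum.atMost_Suc fact_Suc)
qed

text \<open>The signs match because \<open>n + k\<close> and \<open>n - k\<close> have the same
  parity; one minus sign and the factorial are left over from the normalisation of
  \<open>gkernel\<close>.\<close>

lemma gkernel_eq_iterated_kernel:
  assumes g: "derivator g" and "a \<le> s" "x \<le> b"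
  shows "gkernel g (Suc n) x s = - fact (Suc n) * iterated_kernel (stieltjes_on g a b) n s x"
proof (cases "s < x")
  case True
  have sgn: "(- 1) ^ Suc n * ((- 1) ^ k * jump g s ^ (n - k)) = - ((- jump g s) ^ (n - k))" if "k \<le> n" for k
  proof -
    from le_Suc_ex[OF that] obtain m where "n = k + m" ..
    then show ?thesis by (cases "even k") (simp_all add: power_add power_minus[of "jump g s" m])
  qed
  have "gkernel g (Suc n) x s =
      fact (Suc n) * (\<Sum>k\<le>n. (- 1) ^ Suc n * ((- 1) ^ k * jump g s ^ (n - k)) / fact k * gmonom g s k x)"
    using True by (simp add: gkernel_def lessThan_Suc_atMost sum_distrib_left mult.assoc)
  also have "\<dots> = - fact (Suc n) * (\<Sum>k\<le>n. (- jump g s) ^ (n - k) / fact k * gmonom g s k x)"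
    using sgn by (simp add: sum_negf del: fact_Suc power_Suc)
  finally show ?thesis using iterated_kernel_stieltjes_on_eq_sum[OF g \<open>a \<le> s\<close> True \<open>x \<le> b\<close>] by simp
next
  case False
  then show ?thesis by (simp add: gkernel_def iterated_kernel_eq_0)
qed

text \<open>Stated for arbitrary families so that the induction can pass to the shifted ones,
  starting with \<open>\<phi> 1\<close> and \<open>H 1\<close>. The expansion of
  \<open>\<phi> 1\<close> holds at every point of \<open>[a,b]\<close>, but \<open>\<phi> 1\<close>
  agrees with \<open>H 0\<close> only almost everywhere, so it is substituted for \<open>H 0\<close>
  under the integral.\<close>

lemma taylor_expansion:
  fixes \<phi> H :: "nat \<Rightarrow> real \<Rightarrow> real"
  assumes g: "derivator g" and "x \<in> {a..b}"
    and "\<And>i. i \<le> n \<Longrightarrow> integrable (stieltjes_on g a b) (H i)"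
    and "\<And>i x. i \<le> n \<Longrightarrow> x \<in> {a..b} \<Longrightarrow> \<phi> i x = \<phi> i a + cumint (stieltjes_on g a b) (H i) x"
    and "\<And>i. i < n \<Longrightarrow> AE t in stieltjes_on g a b. \<phi> (Suc i) t = H i t"
  shows "\<phi> 0 x = (\<Sum>k\<le>n. \<phi> k a / fact k * gmonom g a k x) + (cumint (stieltjes_on g a b) ^^ Suc n) (H n) x"
  using assms(2-)
proof (induction n arbitrary: \<phi> H x)
  case 0
  show ?case using "0.prems"(3)[OF order_refl "0.prems"(1)] by simp
next
  case (Suc n)
  let ?M = "stieltjes_on g a b" and ?J = "cumint (stieltjes_on g a b)"
  interpret M: finite_borel_measure ?M by (rule finite_borel_measure_stieltjes_on[OF g])
  define c where "c k = \<phi> (Suc k) a / fact k" for k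
  let ?R = "(?J ^^ Suc n) (H (Suc n))"
  have 1: "\<phi> 1 t = (\<Sum>k\<le>n. c k * gmonom g a k t) + ?R t" if "t \<in> {a..b}" for t
  proof -
    have "\<phi> (Suc 0) t = (\<Sum>k\<le>n. \<phi> (Suc k) a / fact k * gmonom g a k t) + (?J ^^ Suc n) (H (Suc n)) t"
      by (rule Suc.IH[of t "\<lambda>k. H (Suc k)" "\<lambda>k. \<phi> (Suc k)", OF that];
          (rule Suc.prems)?; simp)
    then show ?thesis by (simp only: c_def One_nat_def)
  qed
  have iG: "integrable ?M (gmonom g a k)" for k by (rule integrable_gmonom[OF g])
  have iR: "integrable ?M ?R" using Suc.prems(2)[of "Suc n"] by (intro M.integrable_cumint_pow) simp
  have i: "integrable ?M (\<lambda>t. \<Sum>k\<le>n. c k * gmonom g a k t)" "integrable ?M (H 0)"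
    using iG Suc.prems(2)[of 0] by auto
  have "?J (H 0) x = ?J (\<lambda>t. (\<Sum>k\<le>n. c k * gmonom g a k t) + ?R t) x"
    unfolding cumint_def[of _ _ x]
  proof (rule Bochner_Integration.integral_cong_AE)
    show "AE t in ?M. (if t < x then H 0 t else 0) =
        (if t < x then (\<Sum>k\<le>n. c k * gmonom g a k t) + ?R t else 0)"
      using AE_stieltjes_on_range[where g = g and a = a and b = b] Suc.prems(4)[of 0, simplified]
    proof eventually_elim
      case (elim t)
      then show ?case using 1[of t] by simp
    qed
    show "(\<lambda>t. if t < x then H 0 t else 0) \<in> borel_measurable ?M"
      by (rule borel_measurable_integrable) (rule M.integrable_if_less[OF i(2)])
    show "(\<lambda>t. if t < x then (\<Sum>k\<le>n. c k * gmonom g a k t) + ?R t else 0) \<in> borel_measurable ?M"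
      by (rule borel_measurable_integrable)
        (rule M.integrable_if_less[OF Bochner_Integration.integrable_add[OF i(1) iR]])
  qed
  also have "\<dots> = (\<Sum>k\<le>n. c k * ?J (gmonom g a k) x) + ?J ?R x"
    by (simp only: M.cumint_add[OF i(1) iR] M.cumint_sum[OF iG])
  also have "(\<Sum>k\<le>n. c k * ?J (gmonom g a k) x) = (\<Sum>k\<le>n. \<phi> (Suc k) a / fact (Suc k) * gmonom g a (Suc k) x)"
  proof (rule sum.cong[OF refl])
    fix k
    have "?J (gmonom g a k) a = 0"
      using iG measurable_gmonom[OF g] by (simp add: cumint_stieltjes_on_eq set_lebesgue_integral_def)
    then have "gmonom g a (Suc k) x = real (Suc k) * ?J (gmonom g a k) x"
      using gmonom_Suc_stieltjes_on[OF g, of a a b x k] Suc.prems(1) by (simp del: gmonom.simps(2))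
    then show "c k * ?J (gmonom g a k) x = \<phi> (Suc k) a / fact (Suc k) * gmonom g a (Suc k) x"
      by (simp add: c_def del: gmonom.simps(2) of_nat_Suc)
  qed
  finally have "?J (H 0) x = (\<Sum>k\<le>n. \<phi> (Suc k) a / fact (Suc k) * gmonom g a (Suc k) x) + ?J ?R x" .
  then show ?case
    using Suc.prems(3)[OF le0 Suc.prems(1)]
    by (simp add: sum.atMost_Suc_shift del: gmonom.simps(2) sum.atMost_Suc fact_Suc)
qed

text \<open>Integrating from \<open>x1\<close> instead of \<open>x0\<close> changes an
  antiderivative by a constant; these constants are collected in the degree 0 coefficient of
  \<open>c'\<close>.\<close>

lemma gmonom_change_base:
  assumes g: "derivator g" and "k \<le> m"
  shows "\<exists>c. \<forall>x. gmonom g x1 k x = (\<Sum>j\<le>m. c j * gmonom g x0 j x)"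
proof -
  have "\<exists>c. \<forall>x. gmonom g x1 k x = (\<Sum>j\<le>k. c j * gmonom g x0 j x)"
  proof (induction k)
    case 0
    show ?case by (intro exI[of _ "\<lambda>_. 1"]) simp
  next
    case (Suc k)
    then obtain c where "\<And>x. gmonom g x1 k x = (\<Sum>j\<le>k. c j * gmonom g x0 j x)" by blast
    then have c: "gmonom g x1 k = (\<lambda>x. \<Sum>j\<le>k. c j * gmonom g x0 j x)" by blast
    define e where "e j = real (Suc k) * c j / real (Suc j)" for j
    define c' where "c' j = (case j of 0 \<Rightarrow> - (\<Sum>j\<le>k. e j * gmonom g x0 (Suc j) x1) | Suc j \<Rightarrow> e j)" for j
    have "gmonom g x1 (Suc k) x = (\<Sum>j\<le>Suc k. c' j * gmonom g x0 j x)" for x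
    proof -
      \<comment> \<open>This window depends on \<open>x\<close>, but \<open>c'\<close> was fixed
        before it, so one choice of coefficients serves every \<open>x\<close>.\<close>
      define A where "A = min x0 (min x1 x)"
      define B where "B = max x0 (max x1 x)"
      have mem: "x0 \<in> {A..B}" "x1 \<in> {A..B}" "x \<in> {A..B}" by (auto simp: A_def B_def)
      interpret M: finite_borel_measure "stieltjes_on g A B" by (rule finite_borel_measure_stieltjes_on[OF g])
      let ?J = "cumint (stieltjes_on g A B)"
      have J: "?J (gmonom g x1 k) y = (\<Sum>j\<le>k. c j * ?J (gmonom g x0 j) y)" for y
        unfolding c by (rule M.cumint_sum) (rule integrable_gmonom[OF g])
      have "gmonom g x1 (Suc k) x = real (Suc k) * (\<Sum>j\<le>k. c j * (?J (gmonom g x0 j) x - ?J (gmonom g x0 j) x1))"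
        unfolding gmonom_Suc_stieltjes_on[OF g mem(2,3)] J by (simp add: right_diff_distrib sum_subtractf)
      also have "\<dots> = (\<Sum>j\<le>k. e j * (gmonom g x0 (Suc j) x - gmonom g x0 (Suc j) x1))"
        unfolding sum_distrib_left gmonom_Suc_stieltjes_on[OF g mem(1,3)] gmonom_Suc_stieltjes_on[OF g mem(1,2)]
      proof (rule sum.cong[OF refl])
        fix j
        have "real (Suc k) * (c j * (u - w)) = e j * (real (Suc j) * (u - z) - real (Suc j) * (w - z))" for u w z
        proof -
          have "e j * (real (Suc j) * (u - z) - real (Suc j) * (w - z)) = (e j * real (Suc j)) * (u - w)"
            by (simp add: algebra_simps del: of_nat_Suc)
          also have "e j * real (Suc j) = real (Suc k) * c j"
            by (simp add: e_def del: of_nat_Suc)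
          finally show ?thesis by simp
        qed
        then show "real (Suc k) * (c j * (?J (gmonom g x0 j) x - ?J (gmonom g x0 j) x1)) =
            e j * (real (Suc j) * (?J (gmonom g x0 j) x - ?J (gmonom g x0 j) x0) -
              real (Suc j) * (?J (gmonom g x0 j) x1 - ?J (gmonom g x0 j) x0))" .
      qed
      also have "\<dots> = (\<Sum>j\<le>Suc k. c' j * gmonom g x0 j x)"
        by (simp add: sum.atMost_Suc_shift c'_def right_diff_distrib sum_subtractf del: gmonom.simps(2) sum.atMost_Suc)
      finally show ?thesis .
    qed
    then show ?case by blast
  qed
  then obtain c where c: "\<And>x. gmonom g x1 k x = (\<Sum>j\<le>k. c j * gmonom g x0 j x)" by blast
  have "(\<Sum>j\<le>k. c j * gmonom g x0 j x) = (\<Sum>j\<le>m. (if j \<le> k then c j else 0) * gmonom g x0 j x)" for x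
    using \<open>k \<le> m\<close> by (intro sum.mono_neutral_cong_left) auto
  with c show ?thesis by (intro exI[of _ "\<lambda>j. if j \<le> k then c j else 0"]) simp
qed

text \<open>The Taylor polynomial is based at \<open>a\<close>, whereas the space annihilated by
  \<open>L\<close> is spanned by the monomials with an arbitrary base point
  \<open>x0\<close>.\<close>

lemma gpolys_change_base:
  assumes g: "derivator g"
  shows "(\<lambda>x\<in>{a..b}. of_real (\<Sum>k\<le>m. c k * gmonom g x1 k x)) \<in> (gpolys g x0 a b m :: (real \<Rightarrow> 'a::real_normed_field) set)"
proof -
  have "\<exists>d. \<forall>k\<in>{..m}. \<forall>x. gmonom g x1 k x = (\<Sum>j\<le>m. d k j * gmonom g x0 j x)"
    using gmonom_change_base[OF g] by (intro bchoice) auto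
  then obtain d where d: "\<And>k x. k \<le> m \<Longrightarrow> gmonom g x1 k x = (\<Sum>j\<le>m. d k j * gmonom g x0 j x)"
    by auto
  have "(\<Sum>k\<le>m. c k * gmonom g x1 k x) = (\<Sum>j\<le>m. (\<Sum>k\<le>m. c k * d k j) * gmonom g x0 j x)" for x
  proof -
    have "(\<Sum>k\<le>m. c k * gmonom g x1 k x) = (\<Sum>k\<le>m. \<Sum>j\<le>m. c k * d k j * gmonom g x0 j x)"
      using d by (simp add: sum_distrib_left mult.assoc)
    also have "\<dots> = (\<Sum>j\<le>m. \<Sum>k\<le>m. c k * d k j * gmonom g x0 j x)" by (rule sum.swap)
    finally show ?thesis by (simp add: sum_distrib_right)
  qed
  then have "(\<lambda>x\<in>{a..b}. of_real (\<Sum>k\<le>m. c k * gmonom g x1 k x) :: 'a) =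
      (\<lambda>x\<in>{a..b}. \<Sum>j\<le>m. of_real (\<Sum>k\<le>m. c k * d k j) * of_real (gmonom g x0 j x))"
    by simp
  then show ?thesis
    unfolding gpolys_def mem_Collect_eq by (intro exI[of _ "\<lambda>j. of_real (\<Sum>k\<le>m. c k * d k j)"]) simp
qed

section \<open>Regulated functions and integrals for the completed measure\<close>

lemma regulated_of_real:
  fixes F G :: "real \<Rightarrow> real"
  assumes eq: "\<And>x. x \<in> {a..b} \<Longrightarrow> F x = G x"
    and G: "\<And>t. \<exists>l. (G \<longlongrightarrow> l) (at_right t)" "\<And>t. \<exists>l. (G \<longlongrightarrow> l) (at_left t)"
  shows "(\<lambda>x\<in>{a..b}. of_real (F x)) \<in> (regulated a b :: (real \<Rightarrow> 'a::real_normed_field) set)"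
proof -
  let ?f = "(\<lambda>x\<in>{a..b}. of_real (F x)) :: real \<Rightarrow> 'a"
  have "\<exists>l. (?f \<longlongrightarrow> l) (at_right t)" if "t \<in> {a..<b}" for t
  proof -
    obtain l where "(G \<longlongrightarrow> l) (at_right t)" using G(1) by blast
    then have "((\<lambda>x. of_real (G x) :: 'a) \<longlongrightarrow> of_real l) (at_right t)" by (rule tendsto_of_real)
    moreover have "\<forall>\<^sub>F x in at_right t. of_real (G x) = ?f x"
      using that by (intro eventually_at_rightI[of t b]) (auto simp: eq)
    ultimately show ?thesis by (blast intro: Lim_transform_eventually)
  qed
  moreover have "\<exists>l. (?f \<longlongrightarrow> l) (at_left t)" if "t \<in> {a<..b}" for t
  proof -
    obtain l where "(G \<longlongrightarrow> l) (at_left t)" using G(2) by blast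
    then have "((\<lambda>x. of_real (G x) :: 'a) \<longlongrightarrow> of_real l) (at_left t)" by (rule tendsto_of_real)
    moreover have "\<forall>\<^sub>F x in at_left t. of_real (G x) = ?f x"
      using that by (intro eventually_at_leftI[of a]) (auto simp: eq)
    ultimately show ?thesis by (blast intro: Lim_transform_eventually)
  qed
  ultimately show ?thesis by (simp add: regulated_def)
qed

text \<open>In the completion, a set that agrees almost everywhere with a measurable set is
  measurable. This supplies the measurability of the pointwise derivative.\<close>

lemma borel_measurable_completion_AE:
  fixes F G :: "'b \<Rightarrow> 'a::topological_space"
  assumes G: "G \<in> borel_measurable M" and ae: "AE x in M. F x = G x"
  shows "F \<in> borel_measurable (completion M)"
proof (rule measurableI)
  fix A :: "'a set" assume "A \<in> sets borel"
  then have G': "G -` A \<inter> space M \<in> sets (completion M)" using G by (auto intro: measurable_sets)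
  have "AE x in completion M. x \<in> G -` A \<inter> space M \<longleftrightarrow> x \<in> F -` A \<inter> space M"
    using AE_completion[OF ae] by eventually_elim simp
  then have "F -` A \<inter> space M \<in> sets (completion M)"
    by (rule completion.in_sets_AE[OF _ G']) simp
  then show "F -` A \<inter> space (completion M) \<in> sets (completion M)" by simp
qed simp

text \<open>Replaces the pointwise derivative by its Borel density, and the completed measure by the
  finite measure on \<open>[a,b)\<close>, where Fubini is available.\<close>

lemma set_integral_stieltjes_AE:
  fixes F G :: "real \<Rightarrow> 'a::{banach, second_countable_topology}"
  assumes [measurable]: "G \<in> borel_measurable borel" and ae: "AE s in stieltjes_on g a b. F s = G s"
    and int: "integrable (stieltjes_on g a b) G"
  shows "set_integrable (stieltjes g) {a..<b} F"
    and "(LINT s:{a..<b}|stieltjes g. F s) = (\<integral>s. G s \<partial>stieltjes_on g a b)"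
proof -
  have ae0: "AE s in borel_stieltjes g. indicator {a..<b} s *\<^sub>R F s = indicator {a..<b} s *\<^sub>R G s"
    using ae unfolding AE_stieltjes_on by eventually_elim (auto simp: indicator_def)
  have m0: "(\<lambda>s. indicator {a..<b} s *\<^sub>R G s) \<in> borel_measurable (borel_stieltjes g)"
    by measurable
  have m: "(\<lambda>s. indicator {a..<b} s *\<^sub>R F s) \<in> borel_measurable (stieltjes g)"
    and ae': "AE s in stieltjes g. indicator {a..<b} s *\<^sub>R F s = indicator {a..<b} s *\<^sub>R G s"
    unfolding stieltjes_eq
    by (rule borel_measurable_completion_AE[OF m0 ae0], rule AE_completion[OF ae0])
  have m': "(\<lambda>s. indicator {a..<b} s *\<^sub>R G s) \<in> borel_measurable (stieltjes g)"
    unfolding stieltjes_eq by (rule measurable_completion) measurable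
  have G: "set_integrable (stieltjes g) {a..<b} G = set_integrable (stieltjes_on g a b) {a..<b} G"
    "(LINT s:{a..<b}|stieltjes g. G s) = (LINT s:{a..<b}|stieltjes_on g a b. G s)"
    by (simp_all add: set_integral_stieltjes_borel set_integral_stieltjes_on)
  have "set_integrable (stieltjes_on g a b) {a..<b} G"
    unfolding set_integrable_def using int by (intro integrable_mult_indicator) auto
  then show "set_integrable (stieltjes g) {a..<b} F"
    using integrable_cong_AE[OF m m' ae'] by (simp add: G(1)[unfolded set_integrable_def] set_integrable_def)
  have "(LINT s:{a..<b}|stieltjes g. F s) = (LINT s:{a..<b}|stieltjes_on g a b. G s)"
    using Bochner_Integration.integral_cong_AE[OF m m' ae'] G(2) by (simp add: set_lebesgue_integral_def)
  also have "\<dots> = (\<integral>s. G s \<partial>stieltjes_on g a b)"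
    unfolding set_lebesgue_integral_def
    by (rule Bochner_Integration.integral_cong_AE; measurable)
      (use AE_stieltjes_on_range[where g = g and a = a and b = b] in eventually_elim, simp)
  finally show "(LINT s:{a..<b}|stieltjes g. F s) = (\<integral>s. G s \<partial>stieltjes_on g a b)" .
qed

text \<open>Collects all that concerns \<open>f\<close> without \<open>L\<close>: \<open>f\<close>
  is a polynomial minus \<open>u / n!\<close>, with both parts regulated. The nested restriction in
  the last equation keeps the second summand literally in the form in which the homogeneity of
  \<open>L\<close> is stated.\<close>

lemma peano_decomposition:
  fixes f g :: "real \<Rightarrow> real" and a b :: real
  defines "D \<equiv> \<lambda>n s. of_real (gderivs g a b n f s) :: 'a::{real_normed_field, euclidean_space}"
  assumes g: "derivator g" and "a < b" and "n \<ge> 1"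
    and ac: "\<And>k. k \<le> n - 1 \<Longrightarrow> gabs_continuous g a b (gderivs g a b k f)"
  defines "u \<equiv> \<lambda>x\<in>{a..b}. LINT s:{a..<b}|stieltjes g. D n s * of_real (gkernel g n x s)"
  shows "set_integrable (stieltjes g) {a..<b} (D n)" and "u \<in> regulated a b"
    and "\<exists>p\<in>gpolys g x0 a b (n - 1) \<inter> regulated a b.
      (\<lambda>x\<in>{a..b}. of_real (f x)) = (\<lambda>x\<in>{a..b}. p x + (\<lambda>x\<in>{a..b}. - (1 / fact n) * u x) x)"
proof -
  obtain m where n: "n = Suc m" using \<open>n \<ge> 1\<close> by (cases n) auto
  let ?M = "stieltjes_on g a b" and ?J = "cumint (stieltjes_on g a b)"
  let ?\<phi> = "\<lambda>k. gderivs g a b k f"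
  interpret M: finite_borel_measure ?M by (rule finite_borel_measure_stieltjes_on[OF g])
  have "\<exists>H. \<forall>k\<in>{..m}. integrable ?M (H k) \<and> (\<forall>x\<in>{a..b}. ?\<phi> k x = ?\<phi> k a + (LINT t:{a..<x}|?M. H k t)) \<and>
      (AE t in ?M. gderiv g a b (?\<phi> k) t = H k t)"
    using ac n by (intro bchoice ballI gabs_continuous_FTC[OF g \<open>a < b\<close>]) auto
  then obtain H where H': "\<forall>k\<in>{..m}. integrable ?M (H k) \<and>
      (\<forall>x\<in>{a..b}. ?\<phi> k x = ?\<phi> k a + (LINT t:{a..<x}|?M. H k t)) \<and>
      (AE t in ?M. gderiv g a b (?\<phi> k) t = H k t)"
    by (elim exE)
  have H: "\<And>k. k \<le> m \<Longrightarrow> integrable ?M (H k)"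
    "\<And>k x. k \<le> m \<Longrightarrow> x \<in> {a..b} \<Longrightarrow> ?\<phi> k x = ?\<phi> k a + (LINT t:{a..<x}|?M. H k t)"
    "\<And>k. k \<le> m \<Longrightarrow> AE t in ?M. ?\<phi> (Suc k) t = H k t"
    unfolding gderivs.simps(2) using H' by blast+
  have mH: "H k \<in> borel_measurable borel" if "k \<le> m" for k
    using borel_measurable_integrable[OF H(1)[OF that]] by simp
  have \<phi>: "?\<phi> k x = ?\<phi> k a + ?J (H k) x" if "k \<le> m" "x \<in> {a..b}" for k x
    using H(2)[OF that] by (simp add: cumint_stieltjes_on_eq[OF mH[OF that(1)]])
  define R where "R = (?J ^^ n) (H m)"
  have R: "R = ?J ((?J ^^ m) (H m))" by (simp add: R_def n)
  have iR: "integrable ?M ((?J ^^ m) (H m))" by (intro M.integrable_cumint_pow H) simp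
  have taylor: "f x - R x = (\<Sum>k\<le>m. ?\<phi> k a / fact k * gmonom g a k x)" if "x \<in> {a..b}" for x
    using taylor_expansion[of g x a b m H ?\<phi>, OF g that H(1) \<phi>] H(3) by (simp add: R_def n)
  have aeD: "AE s in ?M. D n s = of_real (H m s)"
    using H(3)[OF order_refl] unfolding D_def n by eventually_elim simp
  have [measurable]: "H m \<in> borel_measurable borel" by (rule mH) simp
  show "set_integrable (stieltjes g) {a..<b} (D n)"
    using H(1)[of m] by (intro set_integral_stieltjes_AE(1)[OF _ aeD]) auto
  \<comment> \<open>The kernel representation of the \<open>n\<close>-fold cumulative integral makes
    \<open>u\<close> equal to \<open>- n!\<close> times the Taylor remainder \<open>R\<close>, so
    that its one-sided limits can be read off from \<open>R\<close>.\<close>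
  have u: "u x = of_real (- fact n * R x)" if x: "x \<in> {a..b}" for x
  proof -
    let ?G = "\<lambda>s. H m s * (- fact n * iterated_kernel ?M m s x)"
    have [measurable]: "(\<lambda>s. iterated_kernel ?M m s x) \<in> borel_measurable borel"
    proof -
      have "(\<lambda>s. case_prod (iterated_kernel ?M m) (s, x)) \<in> borel_measurable borel" by measurable
      then show ?thesis by simp
    qed
    have iG: "integrable ?M (\<lambda>s. H m s * iterated_kernel ?M m s x)"
    proof (rule Bochner_Integration.integrable_bound)
      show "integrable ?M (\<lambda>s. H m s * measure ?M UNIV ^ m)" using H(1)[of m] by simp
      show "AE s in ?M. norm (H m s * iterated_kernel ?M m s x) \<le> norm (H m s * measure ?M UNIV ^ m)"
        using M.iterated_kernel_bounds[of m _ x] by (intro AE_I2) (simp add: abs_mult mult_left_mono)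
    qed measurable
    have "AE s in ?M. D n s * of_real (gkernel g n x s) = of_real (?G s)"
      using aeD AE_stieltjes_on_range[where g = g and a = a and b = b]
    proof eventually_elim
      case (elim s)
      then have "gkernel g n x s = - fact n * iterated_kernel ?M m s x"
        unfolding n using x by (intro gkernel_eq_iterated_kernel[OF g]) auto
      then show ?case by (simp only: elim(1) of_real_mult)
    qed
    moreover have iG': "integrable ?M ?G"
      using integrable_mult_right[OF iG, of "- fact n"] by (simp only: mult.left_commute)
    ultimately have "(LINT s:{a..<b}|stieltjes g. D n s * of_real (gkernel g n x s)) = (\<integral>s. of_real (?G s) \<partial>?M)"
      by (intro set_integral_stieltjes_AE(2) integrable_of_real) measurable
    then have "u x = (\<integral>s. of_real (?G s) \<partial>?M)"
      using x by (simp only: u_def restrict_apply' if_True)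
    also have "\<dots> = of_real (\<integral>s. ?G s \<partial>?M)"
      by (rule integral_of_real[OF iG'])
    also have "(\<integral>s. ?G s \<partial>?M) = (- fact n * (\<integral>s. H m s * iterated_kernel ?M m s x \<partial>?M))"
      by (simp only: mult.left_commute[of _ "- fact n"] integral_mult_right_zero)
    also have "(\<integral>s. H m s * iterated_kernel ?M m s x \<partial>?M) = R x"
      unfolding R_def n using H(1)[of m] by (intro M.cumint_pow_eq_integral_iterated_kernel[symmetric]) simp
    finally show ?thesis .
  qed
  have limR: "\<exists>l. (R \<longlongrightarrow> l) (at_right t)" "\<exists>l. (R \<longlongrightarrow> l) (at_left t)" for t
    unfolding R by (rule M.cumint_one_sided_limits[OF iR])+
  have lim0: "\<exists>l. (?J (H 0) \<longlongrightarrow> l) (at_right t)" "\<exists>l. (?J (H 0) \<longlongrightarrow> l) (at_left t)" for t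
    by (rule M.cumint_one_sided_limits[OF H(1)], simp)+
  have "u = (\<lambda>x\<in>{a..b}. of_real (- fact n * R x))"
    using u by (auto simp: u_def fun_eq_iff)
  also have "\<dots> \<in> regulated a b"
  proof (rule regulated_of_real[OF refl])
    fix t
    show "\<exists>l. ((\<lambda>x. - fact n * R x) \<longlongrightarrow> l) (at_right t)"
    proof -
      obtain l where "(R \<longlongrightarrow> l) (at_right t)" using limR(1) by metis
      then have "((\<lambda>x. - fact n * R x) \<longlongrightarrow> - fact n * l) (at_right t)" by (intro tendsto_intros)
      then show ?thesis ..
    qed
    show "\<exists>l. ((\<lambda>x. - fact n * R x) \<longlongrightarrow> l) (at_left t)"
    proof -
      obtain l where "(R \<longlongrightarrow> l) (at_left t)" using limR(2) by metis
      then have "((\<lambda>x. - fact n * R x) \<longlongrightarrow> - fact n * l) (at_left t)" by (intro tendsto_intros)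
      then show ?thesis ..
    qed
  qed
  finally show "u \<in> regulated a b" .
  define p where "p = (\<lambda>x\<in>{a..b}. of_real (f x - R x) :: 'a)"
  have "p \<in> gpolys g x0 a b (n - 1)"
  proof -
    have "p = (\<lambda>x\<in>{a..b}. of_real (\<Sum>k\<le>n - 1. ?\<phi> k a / fact k * gmonom g a k x))"
      unfolding p_def using taylor n by (auto simp: fun_eq_iff simp del: of_real_diff)
    then show ?thesis by (simp only: gpolys_change_base[OF g])
  qed
  \<comment> \<open>The limits are taken from \<open>f - R\<close>, with \<open>f\<close> written as
    a cumulative integral, instead of from the monomials.\<close>
  moreover have "p \<in> regulated a b"
    unfolding p_def
  proof (rule regulated_of_real)
    show "f x - R x = f a + ?J (H 0) x - R x" if "x \<in> {a..b}" for x
      using \<phi>[of 0 x] that by simp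
    fix t
    obtain l1 l2 where "(?J (H 0) \<longlongrightarrow> l1) (at_right t)" "(R \<longlongrightarrow> l2) (at_right t)"
      using lim0(1) limR(1) by metis
    then have "((\<lambda>x. f a + ?J (H 0) x - R x) \<longlongrightarrow> f a + l1 - l2) (at_right t)"
      by (intro tendsto_intros)
    then show "\<exists>l. ((\<lambda>x. f a + ?J (H 0) x - R x) \<longlongrightarrow> l) (at_right t)" ..
    obtain l1 l2 where "(?J (H 0) \<longlongrightarrow> l1) (at_left t)" "(R \<longlongrightarrow> l2) (at_left t)"
      using lim0(2) limR(2) by metis
    then have "((\<lambda>x. f a + ?J (H 0) x - R x) \<longlongrightarrow> f a + l1 - l2) (at_left t)"
      by (intro tendsto_intros)
    then show "\<exists>l. ((\<lambda>x. f a + ?J (H 0) x - R x) \<longlongrightarrow> l) (at_left t)" ..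
  qed
  moreover have "(\<lambda>x\<in>{a..b}. of_real (f x)) = (\<lambda>x\<in>{a..b}. p x + (\<lambda>x\<in>{a..b}. - (1 / fact n) * u x) x)"
    by (auto simp: fun_eq_iff p_def u)
  ultimately show "\<exists>p\<in>gpolys g x0 a b (n - 1) \<inter> regulated a b.
      (\<lambda>x\<in>{a..b}. of_real (f x)) = (\<lambda>x\<in>{a..b}. p x + (\<lambda>x\<in>{a..b}. - (1 / fact n) * u x) x)"
    by blast
qed

lemma regulated_scale:
  assumes "u \<in> regulated a b"
  shows "(\<lambda>x\<in>{a..b}. c * u x) \<in> regulated a b"
proof -
  have "\<exists>l. ((\<lambda>x\<in>{a..b}. c * u x) \<longlongrightarrow> l) (at_right t)" if "t \<in> {a..<b}" for t
  proof -
    have "\<exists>l. (u \<longlongrightarrow> l) (at_right t)" using assms that by (simp add: regulated_def)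
    then obtain l where "(u \<longlongrightarrow> l) (at_right t)" ..
    then have "((\<lambda>x. c * u x) \<longlongrightarrow> c * l) (at_right t)" by (rule tendsto_mult_left)
    moreover have "\<forall>\<^sub>F x in at_right t. c * u x = (\<lambda>x\<in>{a..b}. c * u x) x"
      using that by (intro eventually_at_rightI[of t b]) auto
    ultimately show ?thesis by (blast intro: Lim_transform_eventually)
  qed
  moreover have "\<exists>l. ((\<lambda>x\<in>{a..b}. c * u x) \<longlongrightarrow> l) (at_left t)" if "t \<in> {a<..b}" for t
  proof -
    have "\<exists>l. (u \<longlongrightarrow> l) (at_left t)" using assms that by (simp add: regulated_def)
    then obtain l where "(u \<longlongrightarrow> l) (at_left t)" ..
    then have "((\<lambda>x. c * u x) \<longlongrightarrow> c * l) (at_left t)" by (rule tendsto_mult_left)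
    moreover have "\<forall>\<^sub>F x in at_left t. c * u x = (\<lambda>x\<in>{a..b}. c * u x) x"
      using that by (intro eventually_at_leftI[of a]) auto
    ultimately show ?thesis by (blast intro: Lim_transform_eventually)
  qed
  ultimately show ?thesis by (simp add: regulated_def)
qed

text \<open>The Bochner integral of a non-integrable function is 0 by convention, so hypothesis I
  and the conclusion state integrability beside each equation. Hypothesis I is applied to the
  derivative of order \<open>n\<close>, whose integrability comes with the decomposition.\<close>

theorem theorem9p7:
  fixes g :: "real \<Rightarrow> real" and a b x0 :: real and n :: nat
  assumes "derivator g" and "a < b" and "n \<ge> 1"
  shows
    "(\<forall>L :: (real \<Rightarrow> 'a::{real_normed_field, euclidean_space}) \<Rightarrow> 'a.
        regulated_functional a b L \<longrightarrow>
        (\<forall>f. set_integrable (stieltjes g) {a..<b} f \<longrightarrow>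
           set_integrable (stieltjes g) {a..<b}
             (\<lambda>s. f s * L (\<lambda>x\<in>{a..b}. of_real (gkernel g n x s))) \<and>
           L (\<lambda>x\<in>{a..b}. LINT s:{a..<b}|stieltjes g. f s * of_real (gkernel g n x s)) =
             (LINT s:{a..<b}|stieltjes g. f s * L (\<lambda>x\<in>{a..b}. of_real (gkernel g n x s)))) \<longrightarrow>
        (\<forall>p\<in>gpolys g x0 a b (n - 1). L p = 0) \<longrightarrow>
        (\<forall>f :: real \<Rightarrow> real.
           gdifferentiable_times g a b (n - 1) f \<longrightarrow>
           (\<forall>k\<le>n - 1. gabs_continuous g a b (gderivs g a b k f)) \<longrightarrow>
           set_integrable (stieltjes g) {a..<b}
             (\<lambda>s. of_real (gderivs g a b n f s) * L (\<lambda>x\<in>{a..b}. of_real (gkernel g n x s))) \<and>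
           L (\<lambda>x\<in>{a..b}. of_real (f x)) =
             - (1 / fact n) * (LINT s:{a..<b}|stieltjes g.
                 of_real (gderivs g a b n f s) * L (\<lambda>x\<in>{a..b}. of_real (gkernel g n x s)))))
     \<and>
     (\<forall>L :: (real \<Rightarrow> 'a) \<Rightarrow> (real \<Rightarrow> 'a).
        regulated_endomorphism a b L \<longrightarrow>
        (\<forall>f. set_integrable (stieltjes g) {a..<b} f \<longrightarrow>
           (\<forall>y\<in>{a..b}.
              set_integrable (stieltjes g) {a..<b}
                (\<lambda>s. f s * L (\<lambda>x\<in>{a..b}. of_real (gkernel g n x s)) y) \<and>
              L (\<lambda>x\<in>{a..b}. LINT s:{a..<b}|stieltjes g. f s * of_real (gkernel g n x s)) y =
                (LINT s:{a..<b}|stieltjes g.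
                   f s * L (\<lambda>x\<in>{a..b}. of_real (gkernel g n x s)) y))) \<longrightarrow>
        (\<forall>p\<in>gpolys g x0 a b (n - 1). L p = (\<lambda>y\<in>{a..b}. 0)) \<longrightarrow>
        (\<forall>f :: real \<Rightarrow> real.
           gdifferentiable_times g a b (n - 1) f \<longrightarrow>
           (\<forall>k\<le>n - 1. gabs_continuous g a b (gderivs g a b k f)) \<longrightarrow>
           (\<forall>y\<in>{a..b}.
              set_integrable (stieltjes g) {a..<b}
                (\<lambda>s. of_real (gderivs g a b n f s) *
                   L (\<lambda>x\<in>{a..b}. of_real (gkernel g n x s)) y) \<and>
              L (\<lambda>x\<in>{a..b}. of_real (f x)) y =
                - (1 / fact n) * (LINT s:{a..<b}|stieltjes g.
                    of_real (gderivs g a b n f s) *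
                    L (\<lambda>x\<in>{a..b}. of_real (gkernel g n x s)) y))))"
proof (intro conjI allI impI ballI)
  fix L :: "(real \<Rightarrow> 'a) \<Rightarrow> 'a" and f :: "real \<Rightarrow> real"
  assume L: "regulated_functional a b L"
    and I: "\<forall>f. set_integrable (stieltjes g) {a..<b} f \<longrightarrow>
           set_integrable (stieltjes g) {a..<b}
             (\<lambda>s. f s * L (\<lambda>x\<in>{a..b}. of_real (gkernel g n x s))) \<and>
           L (\<lambda>x\<in>{a..b}. LINT s:{a..<b}|stieltjes g. f s * of_real (gkernel g n x s)) =
             (LINT s:{a..<b}|stieltjes g. f s * L (\<lambda>x\<in>{a..b}. of_real (gkernel g n x s)))"
    and II: "\<forall>p\<in>gpolys g x0 a b (n - 1). L p = 0"
    and ac: "\<forall>k\<le>n - 1. gabs_continuous g a b (gderivs g a b k f)"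
  let ?u = "\<lambda>x\<in>{a..b}. LINT s:{a..<b}|stieltjes g. of_real (gderivs g a b n f s) * of_real (gkernel g n x s) :: 'a"
  note dec = peano_decomposition[where 'a = 'a and f = f, OF assms ac[rule_format]]
  note I' = I[rule_format, OF dec(1)]
  from I' show "set_integrable (stieltjes g) {a..<b}
      (\<lambda>s. of_real (gderivs g a b n f s) * L (\<lambda>x\<in>{a..b}. of_real (gkernel g n x s)))" by simp
  from dec(3)[of x0] obtain p where p: "p \<in> gpolys g x0 a b (n - 1)" "p \<in> regulated a b"
    "(\<lambda>x\<in>{a..b}. of_real (f x)) = (\<lambda>x\<in>{a..b}. p x + (\<lambda>x\<in>{a..b}. - (1 / fact n) * ?u x) x)"
    by blast
  note L' = L[unfolded regulated_functional_def]
  have L_scale: "L (\<lambda>x\<in>{a..b}. c * v x) = c * L v" and L_add: "L (\<lambda>x\<in>{a..b}. w x + v x) = L w + L v"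
    if "v \<in> regulated a b" "w \<in> regulated a b" for c v w
    using L' that by blast+
  have "L (\<lambda>x\<in>{a..b}. of_real (f x)) = L p + L (\<lambda>x\<in>{a..b}. - (1 / fact n) * ?u x)"
    unfolding p(3) by (rule L_add[OF regulated_scale[OF dec(2)] p(2)])
  also have "\<dots> = - (1 / fact n) * L ?u"
    using II p(1) L_scale[OF dec(2) p(2), of "- (1 / fact n)"] by simp
  finally show "L (\<lambda>x\<in>{a..b}. of_real (f x)) = - (1 / fact n) * (LINT s:{a..<b}|stieltjes g.
      of_real (gderivs g a b n f s) * L (\<lambda>x\<in>{a..b}. of_real (gkernel g n x s)))"
    using I' by simp
next
  fix L :: "(real \<Rightarrow> 'a) \<Rightarrow> (real \<Rightarrow> 'a)" and f :: "real \<Rightarrow> real" and y :: real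
  assume L: "regulated_endomorphism a b L"
    and I: "\<forall>f. set_integrable (stieltjes g) {a..<b} f \<longrightarrow>
           (\<forall>y\<in>{a..b}.
              set_integrable (stieltjes g) {a..<b}
                (\<lambda>s. f s * L (\<lambda>x\<in>{a..b}. of_real (gkernel g n x s)) y) \<and>
              L (\<lambda>x\<in>{a..b}. LINT s:{a..<b}|stieltjes g. f s * of_real (gkernel g n x s)) y =
                (LINT s:{a..<b}|stieltjes g.
                   f s * L (\<lambda>x\<in>{a..b}. of_real (gkernel g n x s)) y))"
    and II: "\<forall>p\<in>gpolys g x0 a b (n - 1). L p = (\<lambda>y\<in>{a..b}. 0)"
    and ac: "\<forall>k\<le>n - 1. gabs_continuous g a b (gderivs g a b k f)"
    and y: "y \<in> {a..b}"
  let ?u = "\<lambda>x\<in>{a..b}. LINT s:{a..<b}|stieltjes g. of_real (gderivs g a b n f s) * of_real (gkernel g n x s) :: 'a"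
  note dec = peano_decomposition[where 'a = 'a and f = f, OF assms ac[rule_format]]
  note I' = I[rule_format, OF dec(1) y]
  from I' show "set_integrable (stieltjes g) {a..<b}
      (\<lambda>s. of_real (gderivs g a b n f s) * L (\<lambda>x\<in>{a..b}. of_real (gkernel g n x s)) y)" by simp
  from dec(3)[of x0] obtain p where p: "p \<in> gpolys g x0 a b (n - 1)" "p \<in> regulated a b"
    "(\<lambda>x\<in>{a..b}. of_real (f x)) = (\<lambda>x\<in>{a..b}. p x + (\<lambda>x\<in>{a..b}. - (1 / fact n) * ?u x) x)"
    by blast
  note L' = L[unfolded regulated_endomorphism_def]
  have L_scale: "L (\<lambda>x\<in>{a..b}. c * v x) = (\<lambda>x\<in>{a..b}. c * L v x)"
    and L_add: "L (\<lambda>x\<in>{a..b}. w x + v x) = (\<lambda>x\<in>{a..b}. L w x + L v x)"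
    if "v \<in> regulated a b" "w \<in> regulated a b" for c v w
    using L' that by blast+
  have "L (\<lambda>x\<in>{a..b}. of_real (f x)) = (\<lambda>x\<in>{a..b}. L p x + L (\<lambda>x\<in>{a..b}. - (1 / fact n) * ?u x) x)"
    unfolding p(3) by (rule L_add[OF regulated_scale[OF dec(2)] p(2)])
  then have "L (\<lambda>x\<in>{a..b}. of_real (f x)) y = L p y + L (\<lambda>x\<in>{a..b}. - (1 / fact n) * ?u x) y"
    using y by simp
  also have "\<dots> = - (1 / fact n) * L ?u y"
    using II p(1) L_scale[OF dec(2) p(2), of "- (1 / fact n)"] y by simp
  finally show "L (\<lambda>x\<in>{a..b}. of_real (f x)) y = - (1 / fact n) * (LINT s:{a..<b}|stieltjes g.
      of_real (gderivs g a b n f s) * L (\<lambda>x\<in>{a..b}. of_real (gkernel g n x s)) y)"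
    using I' by simp
qed

end
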